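(* Let $m\ge 1$ and let $v:\mathbb{C}^m\to\mathbb{R}$ be a smooth plurisubharmonic function satisfying, for all $x\in\mathbb{C}^m$, $$\ln\det \partial\bar\partial v(x)=\frac12\,x\cdot Dv(x)-v(x).$$ Suppose that at least one of the following holds: (i) there exist $\delta>0$ and $R>0$ such that $\partial\bar\partial v(x)\ge \dfrac{2m-1+\delta}{2|x|^2}\,I$ for all $x\in\mathbb{C}^m$ with $|x|\ge R$; or (ii) $v$ is radially symmetric (that is, $v(x)$ depends only on $|x|$). Then $v$ is a quadratic polynomial; precisely, $$v(x)=v(0)+\frac12\langle D^2v(0)\,x,x\rangle_{\mathbb{R}^{2m}}\qquad\text{for all }x\in\mathbb{C}^m\cong\mathbb{R}^{2m}.$$
   Context: Identify $\mathbb{C}^m$ with $\mathbb{R}^{2m}$ through $z_k=x_k+\sqrt{-1}\,y_k$, $k=1,\dots,m$. $Dv$ and $D^2v$ denote the real Euclidean gradient and real $2m\times 2m$ Hessian of $v$ on $\mathbb{R}^{2m}$; $x\cdot Dv(x)$ is the real Euclidean inner product on $\mathbb{R}^{2m}$, i.e. $x\cdot Dv=\sum_{k}(z_k\,\partial_{z_k}v+\bar z_k\,\partial_{\bar z_k}v)$; $|x|$ is the Euclidean norm. $\partial\bar\partial v$ denotes the $m\times m$ Hermitian matrix $\left(\frac{\partial^2 v}{\partial z_i\partial\bar z_j}\right)_{1\le i,j\le m}$ (the complex Hessian), with $\partial_{z_k}=\frac12(\partial_{x_k}-\sqrt{-1}\,\partial_{y_k})$ and $\partial_{\bar z_k}=\frac12(\partial_{x_k}+\sqrt{-1}\,\partial_{y_k})$.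 $I$ is the $m\times m$ identity matrix, and inequalities between Hermitian matrices are in the sense of Hermitian forms. Smooth means $C^\infty$. That $v$ solves the equation includes that $\det\partial\bar\partial v(x)>0$ everywhere, so that the logarithm is defined. *)

theory Defs
  imports "HOL-Analysis.Analysis"
begin

text \<open>
  The space \<open>complex ^ 'm\<close> is \<open>\<complex>\<^sup>m\<close> with \<open>m = CARD('m)\<close>. Its library norm and its library inner
  product (\<open>\<bullet>\<close>, real-valued) are those of \<open>\<real>\<^sup>2\<^sup>m\<close>, and its library \<open>Basis\<close> consists of the real
  coordinate directions: \<open>axis k 1\<close> for \<open>x\<^sub>k\<close> and \<open>axis k \<i>\<close> for \<open>y\<^sub>k\<close>.
\<close>

definition dir_deriv ::
  "'a::real_normed_vector \<Rightarrow> ('a \<Rightarrow> 'b::real_normed_vector) \<Rightarrow> 'a \<Rightarrow> 'b" where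
  "dir_deriv w f x = frechet_derivative f (at x) w"

primrec C_k :: "nat \<Rightarrow> ('a::euclidean_space \<Rightarrow> 'b::real_normed_vector) \<Rightarrow> bool" where
  "C_k 0 f \<longleftrightarrow> continuous_on UNIV f"
| "C_k (Suc k) f \<longleftrightarrow>
     (\<forall>x. f differentiable (at x)) \<and> (\<forall>b\<in>Basis. C_k k (dir_deriv b f))"

definition smooth :: "('a::euclidean_space \<Rightarrow> 'b::real_normed_vector) \<Rightarrow> bool" where
  "smooth f \<longleftrightarrow> (\<forall>k. C_k k f)"

definition gradient :: "('a::euclidean_space \<Rightarrow> real) \<Rightarrow> 'a \<Rightarrow> 'a" where
  "gradient f x = (\<Sum>b\<in>Basis. dir_deriv b f x *\<^sub>R b)"

text \<open>The real Hessian at \<open>x\<close>, as the linear operator \<open>h \<mapsto> D\<^sup>2f(x) h\<close>.\<close>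

definition hessian :: "('a::euclidean_space \<Rightarrow> real) \<Rightarrow> 'a \<Rightarrow> 'a \<Rightarrow> 'a" where
  "hessian f x h =
     (\<Sum>b\<in>Basis. (\<Sum>c\<in>Basis. dir_deriv b (dir_deriv c f) x * (h \<bullet> c)) *\<^sub>R b)"

definition d_z :: "'m::finite \<Rightarrow> (complex ^ 'm \<Rightarrow> complex) \<Rightarrow> complex ^ 'm \<Rightarrow> complex" where
  "d_z k f x = (dir_deriv (axis k 1) f x - \<i> * dir_deriv (axis k \<i>) f x) / 2"

definition d_zbar :: "'m::finite \<Rightarrow> (complex ^ 'm \<Rightarrow> complex) \<Rightarrow> complex ^ 'm \<Rightarrow> complex" where
  "d_zbar k f x = (dir_deriv (axis k 1) f x + \<i> * dir_deriv (axis k \<i>) f x) / 2"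

definition complex_hessian ::
  "(complex ^ 'm::finite \<Rightarrow> real) \<Rightarrow> complex ^ 'm \<Rightarrow> complex ^ 'm ^ 'm" where
  "complex_hessian v x = (\<chi> i j. d_z i (d_zbar j (\<lambda>y. complex_of_real (v y))) x)"

definition herm_form :: "complex ^ 'm ^ 'm \<Rightarrow> complex ^ 'm::finite \<Rightarrow> complex" where
  "herm_form A \<xi> = (\<Sum>i\<in>UNIV. \<Sum>j\<in>UNIV. A $ i $ j * \<xi> $ i * cnj (\<xi> $ j))"

text \<open>
  The order on Hermitian matrices. The forms of Hermitian matrices take real values, so \<open>Re\<close>
  only changes the type. No meaning is intended for matrices that are not Hermitian.
\<close>

definition herm_le :: "complex ^ 'm ^ 'm \<Rightarrow> complex ^ 'm ^ 'm::finite \<Rightarrow> bool" where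
  "herm_le A B \<longleftrightarrow> (\<forall>\<xi>. Re (herm_form A \<xi>) \<le> Re (herm_form B \<xi>))"

text \<open>
  Plurisubharmonicity on all of \<open>\<complex>\<^sup>m\<close>: upper semicontinuity and the sub-mean value inequality on
  every circle in every complex line. For a function without the value \<open>-\<infinity>\<close> that inequality
  forces the circle integral (of a function bounded above) to be finite, whence the
  integrability conjunct.
\<close>

definition upper_semicontinuous :: "('a::topological_space \<Rightarrow> real) \<Rightarrow> bool" where
  "upper_semicontinuous f \<longleftrightarrow> (\<forall>c. open {x. f x < c})"

definition plurisubharmonic :: "(complex ^ 'm::finite \<Rightarrow> real) \<Rightarrow> bool" where
  "plurisubharmonic v \<longleftrightarrow> upper_semicontinuous v \<and>
     (\<forall>a w. (\<lambda>\<theta>. v (a + cis \<theta> *s w)) absolutely_integrable_on {0..2 * pi} \<and>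
            v a \<le> 1 / (2 * pi) * integral {0..2 * pi} (\<lambda>\<theta>. v (a + cis \<theta> *s w)))"

definition radially_symmetric :: "('a::real_normed_vector \<Rightarrow> real) \<Rightarrow> bool" where
  "radially_symmetric v \<longleftrightarrow> (\<forall>x y. norm x = norm y \<longrightarrow> v x = v y)"

text \<open>
  The complex Hessian of a smooth real function is Hermitian, so its determinant is real and
  \<open>Re\<close> only changes the type. Positivity is stated because \<open>ln\<close> is total in the library.
\<close>

definition solves_equation :: "(complex ^ 'm::finite \<Rightarrow> real) \<Rightarrow> bool" where
  "solves_equation v \<longleftrightarrow>
     (\<forall>x. Re (det (complex_hessian v x)) > 0 \<and>
          ln (Re (det (complex_hessian v x))) = 1 / 2 * (x \<bullet> gradient v x) - v x)"

end

theory Submission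
  imports Defs "HOL-Real_Asymp.Real_Asymp"
begin

text \<open>
  Write \<open>H f\<close> for the complex Hessian of \<open>f\<close> and put \<open>\<phi> = \<onehalf> x \<bullet> Dv - v = ln det (H v)\<close>.
  Differentiating both expressions for \<open>\<phi>\<close> shows \<open>L \<phi> = 0\<close> for the elliptic operator
  \<open>L f = tr ((H v)\<inverse> H f) - \<onehalf> x \<bullet> Df\<close>. If \<open>\<phi>\<close> is constant, then the second derivatives of \<open>v\<close> are
  homogeneous of degree 0 and continuous at 0, hence constant, and \<open>v\<close> is quadratic.

  If \<open>v\<close> is radial, then \<open>\<phi>\<close> is constant on every sphere, so the weak maximum principle for \<open>\<phi>\<close> and
  \<open>-\<phi>\<close> on balls makes it constant. Under the lower bound on \<open>H v\<close>, the function \<open>|x|\<close> satisfies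
  \<open>L |x| < 0\<close> outside a ball, while \<open>\<phi> = ln det (H v)\<close> decreases at most logarithmically. Comparing
  \<open>\<phi> + \<epsilon>|x|\<close> with its values on a large annulus and letting \<open>\<epsilon>\<close> tend to 0 shows that \<open>\<phi>\<close> attains
  its minimum, and the strong minimum principle applies.
\<close>

section \<open>Directional derivatives of smooth functions\<close>

text \<open>That \<open>L \<phi> = 0\<close> rests on scaling: with the coefficient 1/2, the second
  derivatives of \<open>\<phi>\<close> are half the radial derivatives of those of \<open>v\<close>,
  with no term of lower order left.

  The obstacle is noncompactness: the infimum of \<open>\<phi>\<close> might be approached only at
  infinity, and the lower bound on \<open>H v\<close> has to exclude this. Write it as
  \<open>H v \<ge> \<kappa> I\<close> with \<open>\<kappa> = c / (2 |x|^2)\<close>, so that the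
  inverse of \<open>H v\<close> is at most \<open>1 / \<kappa>\<close>. In \<open>L |x|\<close> the
  m - 1 complex directions orthogonal to x count fully, but the complex direction of x only by half,
  because |x| is linear along the real ray and curved only along \<open>i x\<close>. The
  second-order part is thus at most \<open>(2m - 1) |x| / (2c)\<close>, against a drift of
  \<open>- |x| / 2\<close>; this is the origin of the constant 2m - 1. The same bound gives
  \<open>det (H v) \<ge> \<kappa>^m\<close>, whence the logarithmic rate. Upper bounds on
  \<open>H v\<close> enter only through compactness, in the barriers.\<close>

lemma smooth_differentiable: "smooth f \<Longrightarrow> f differentiable (at x)"
  unfolding smooth_def by (metis C_k.simps(2))

lemma dir_deriv_eqI: "(f has_derivative D) (at x) \<Longrightarrow> dir_deriv w f x = D w"
  unfolding dir_deriv_def using frechet_derivative_at by metis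

lemma differentiable_has_derivative:
  "f differentiable (at x) \<Longrightarrow> (f has_derivative (\<lambda>h. dir_deriv h f x)) (at x)"
  unfolding dir_deriv_def by (metis eta_contract_eq frechet_derivative_works)

lemma smooth_has_derivative: "smooth f \<Longrightarrow> (f has_derivative (\<lambda>h. dir_deriv h f x)) (at x)"
  by (simp add: differentiable_has_derivative smooth_differentiable)

lemma smooth_continuous: "smooth f \<Longrightarrow> continuous_on S f"
  by (meson continuous_at_imp_continuous_on differentiable_imp_continuous_within smooth_differentiable)

lemma dir_deriv_linear:
  assumes "smooth f" shows "linear (\<lambda>h. dir_deriv h f x)"
  using smooth_has_derivative[OF assms] has_derivative_linear by blast

lemma dir_deriv_sum_Basis:
  assumes "smooth f"
  shows "dir_deriv h f x = (\<Sum>b\<in>Basis. (h \<bullet> b) *\<^sub>R dir_deriv b f x)"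
proof -
  interpret linear "\<lambda>h. dir_deriv h f x" by (rule dir_deriv_linear[OF assms])
  have "dir_deriv (\<Sum>b\<in>Basis. (h \<bullet> b) *\<^sub>R b) f x = (\<Sum>b\<in>Basis. (h \<bullet> b) *\<^sub>R dir_deriv b f x)"
    by (simp add: sum scale)
  then show ?thesis by (simp add: euclidean_representation)
qed

lemma C_k_zero: "C_k k (\<lambda>x. 0)"
proof (induction k)
  case (Suc k)
  have "dir_deriv b (\<lambda>x::'a. 0::'b) = (\<lambda>x. 0)" for b :: 'a
    by (rule ext, rule dir_deriv_eqI) (auto intro!: derivative_eq_intros)
  then show ?case using Suc by simp
qed auto

lemma C_k_add_scaleR:
  "C_k k f \<Longrightarrow> C_k k g \<Longrightarrow> C_k k (\<lambda>x. f x + c *\<^sub>R g x)"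
proof (induction k arbitrary: f g)
  case 0 then show ?case by (auto intro!: continuous_intros)
next
  case (Suc k)
  have D: "((\<lambda>x. f x + c *\<^sub>R g x) has_derivative (\<lambda>h. dir_deriv h f x + c *\<^sub>R dir_deriv h g x)) (at x)" for x
    using Suc.prems by (auto intro!: derivative_eq_intros differentiable_has_derivative)
  have "dir_deriv b (\<lambda>x. f x + c *\<^sub>R g x) = (\<lambda>x. dir_deriv b f x + c *\<^sub>R dir_deriv b g x)" for b
    by (rule ext, rule dir_deriv_eqI[OF D])
  moreover have "(\<lambda>x. f x + c *\<^sub>R g x) differentiable (at x)" for x
    using D unfolding differentiable_def by blast
  ultimately show ?case using Suc by simp
qed

lemma C_k_sum:
  "finite B \<Longrightarrow> (\<And>b. b \<in> B \<Longrightarrow> C_k k (f b)) \<Longrightarrow> C_k k (\<lambda>x. \<Sum>b\<in>B. c b *\<^sub>R f b x)"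
proof (induction B rule: finite_induct)
  case empty then show ?case by (simp add: C_k_zero)
next
  case (insert b B)
  then have "C_k k (\<lambda>x. (\<Sum>b\<in>B. c b *\<^sub>R f b x) + c b *\<^sub>R f b x)"
    by (intro C_k_add_scaleR) auto
  then show ?case using insert by (simp add: add.commute)
qed

text \<open>\<open>C_k\<close> recurs only over coordinate directions; any other direction is a
  combination of these with constant coefficients, and \<open>C_k\<close> is closed under such
  combinations.\<close>

lemma smooth_dir_deriv: assumes "smooth f" shows "smooth (dir_deriv h f)"
proof -
  have "C_k k (dir_deriv b f)" if "b \<in> Basis" for b k
    using assms that unfolding smooth_def by (metis C_k.simps(2))
  then have "C_k k (\<lambda>x. \<Sum>b\<in>Basis. (h \<bullet> b) *\<^sub>R dir_deriv b f x)" for k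
    by (intro C_k_sum) auto
  then show ?thesis unfolding smooth_def using dir_deriv_sum_Basis[OF assms, of h] by presburger
qed

lemma has_derivative_line:
  fixes f :: "'a::real_normed_vector \<Rightarrow> real"
  assumes "(f has_derivative D) (at (x + s *\<^sub>R h))"
  shows "((\<lambda>s. f (x + s *\<^sub>R h)) has_real_derivative D h) (at s)"
proof -
  have "((\<lambda>s. x + s *\<^sub>R h) has_derivative (\<lambda>d. d *\<^sub>R h)) (at s)"
    by (auto intro!: derivative_eq_intros)
  from has_derivative_compose[OF this assms]
  have "((\<lambda>s. f (x + s *\<^sub>R h)) has_derivative (\<lambda>d. D (d *\<^sub>R h))) (at s)" .
  moreover have "D (d *\<^sub>R h) = d * D h" for d
    using linear_scale[OF has_derivative_linear[OF assms]] by simp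
  ultimately show ?thesis by (simp add: has_field_derivative_def mult.commute[of _ "D h"])
qed

lemma dir_deriv_line:
  fixes f :: "'a::euclidean_space \<Rightarrow> real"
  assumes "smooth f"
  shows "((\<lambda>s. f (x + s *\<^sub>R h)) has_real_derivative dir_deriv h f (x + s *\<^sub>R h)) (at s)"
  by (rule has_derivative_line[OF smooth_has_derivative[OF assms]])

lemma second_difference_mvt:
  fixes f :: "'a::euclidean_space \<Rightarrow> real"
  assumes "smooth f" "t > 0"
  shows "\<exists>a b. 0 < a \<and> a < t \<and> 0 < b \<and> b < t \<and>
    f (x + t *\<^sub>R h + t *\<^sub>R k) - f (x + t *\<^sub>R h) - f (x + t *\<^sub>R k) + f x
      = t * t * dir_deriv k (dir_deriv h f) (x + a *\<^sub>R h + b *\<^sub>R k)"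
proof -
  define g where "g s = f ((x + t *\<^sub>R k) + s *\<^sub>R h) - f (x + s *\<^sub>R h)" for s
  have g: "(g has_real_derivative dir_deriv h f ((x + t *\<^sub>R k) + s *\<^sub>R h) - dir_deriv h f (x + s *\<^sub>R h)) (at s)" for s
    unfolding g_def by (intro DERIV_diff dir_deriv_line assms)
  have "\<exists>a>0. a < t \<and> g t - g 0 = (t - 0) * (dir_deriv h f ((x + t *\<^sub>R k) + a *\<^sub>R h) - dir_deriv h f (x + a *\<^sub>R h))"
    by (rule MVT2[OF \<open>t > 0\<close>]) (rule g)
  then obtain a where a: "0 < a" "a < t"
    "g t - g 0 = (t - 0) * (dir_deriv h f ((x + t *\<^sub>R k) + a *\<^sub>R h) - dir_deriv h f (x + a *\<^sub>R h))"
    by blast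
  have l: "((\<lambda>s. dir_deriv h f ((x + a *\<^sub>R h) + s *\<^sub>R k)) has_real_derivative
      dir_deriv k (dir_deriv h f) ((x + a *\<^sub>R h) + s *\<^sub>R k)) (at s)" for s
    by (intro dir_deriv_line smooth_dir_deriv assms)
  have "\<exists>b>0. b < t \<and> dir_deriv h f ((x + a *\<^sub>R h) + t *\<^sub>R k) - dir_deriv h f ((x + a *\<^sub>R h) + 0 *\<^sub>R k)
       = (t - 0) * dir_deriv k (dir_deriv h f) ((x + a *\<^sub>R h) + b *\<^sub>R k)"
    by (rule MVT2[OF \<open>t > 0\<close>]) (rule l)
  then obtain b where b: "0 < b" "b < t"
    "dir_deriv h f ((x + a *\<^sub>R h) + t *\<^sub>R k) - dir_deriv h f ((x + a *\<^sub>R h) + 0 *\<^sub>R k)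
       = (t - 0) * dir_deriv k (dir_deriv h f) ((x + a *\<^sub>R h) + b *\<^sub>R k)"
    by blast
  show ?thesis
    using a b by (intro exI[of _ a] exI[of _ b]) (simp add: g_def algebra_simps)
qed

text \<open>The second difference quotient is symmetric in \<open>h\<close> and \<open>k\<close>;
  applying the mean value theorem twice, in either order, shows that it converges to either mixed
  derivative.\<close>

lemma dir_deriv_commute:
  fixes f :: "'a::euclidean_space \<Rightarrow> real"
  assumes "smooth f"
  shows "dir_deriv h (dir_deriv k f) x = dir_deriv k (dir_deriv h f) x"
proof -
  let ?p = "\<lambda>h k. dir_deriv k (dir_deriv h f)"
  have lim: "((\<lambda>t. (f (x + t *\<^sub>R h + t *\<^sub>R k) - f (x + t *\<^sub>R h) - f (x + t *\<^sub>R k) + f x) / (t * t))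
      \<longlongrightarrow> ?p h k x) (at_right 0)" for h k
  proof (rule tendstoI)
    fix e :: real assume "e > 0"
    have "isCont (?p h k) x"
      using smooth_continuous[OF smooth_dir_deriv[OF smooth_dir_deriv[OF assms]], of UNIV]
      by (simp add: continuous_on_eq_continuous_at)
    then obtain d where d: "d > 0" "\<And>y. dist y x < d \<Longrightarrow> dist (?p h k y) (?p h k x) < e"
      using \<open>e > 0\<close> unfolding continuous_at_eps_delta by blast
    \<comment> \<open>Keeps the intermediate point \<open>x + a h + b k\<close> within distance
      \<open>d\<close> of \<open>x\<close>; the summand 1 covers \<open>h = k = 0\<close>.\<close>
    define r where "r = d / (1 + norm h + norm k)"
    have pos: "1 + norm h + norm k > 0" using norm_ge_zero[of h] norm_ge_zero[of k] by linarith
    have r: "r > 0" unfolding r_def using d pos by auto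
    have "dist ((f (x + t *\<^sub>R h + t *\<^sub>R k) - f (x + t *\<^sub>R h) - f (x + t *\<^sub>R k) + f x) / (t * t)) (?p h k x) < e"
      if t: "0 < t" "t < r" for t
    proof -
      obtain a b where ab: "0 < a" "a < t" "0 < b" "b < t" "f (x + t *\<^sub>R h + t *\<^sub>R k) - f (x + t *\<^sub>R h) - f (x + t *\<^sub>R k) + f x
      = t * t * ?p h k (x + a *\<^sub>R h + b *\<^sub>R k)"
        using second_difference_mvt[OF assms \<open>0 < t\<close>] by metis
      have "norm (a *\<^sub>R h + b *\<^sub>R k) \<le> a * norm h + b * norm k"
        by (rule order_trans[OF norm_triangle_ineq]) (use ab in simp)
      also have "\<dots> \<le> t * norm h + t * norm k"
        using ab by (intro add_mono mult_right_mono) auto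
      also have "\<dots> < t * (1 + norm h + norm k)" using t by (simp add: algebra_simps)
      also have "\<dots> \<le> d" using t pos unfolding r_def by (simp add: field_simps)
      finally have "dist (x + a *\<^sub>R h + b *\<^sub>R k) x < d" by (simp add: dist_norm add.assoc)
      from d(2)[OF this] show ?thesis using ab t by simp
    qed
    then show "\<forall>\<^sub>F t in at_right 0. dist ((f (x + t *\<^sub>R h + t *\<^sub>R k) - f (x + t *\<^sub>R h) - f (x + t *\<^sub>R k) + f x) / (t * t)) (?p h k x) < e"
      using r by (auto simp: eventually_at_right_field)
  qed
  have "(\<lambda>t. (f (x + t *\<^sub>R k + t *\<^sub>R h) - f (x + t *\<^sub>R k) - f (x + t *\<^sub>R h) + f x) / (t * t)) =
    (\<lambda>t. (f (x + t *\<^sub>R h + t *\<^sub>R k) - f (x + t *\<^sub>R h) - f (x + t *\<^sub>R k) + f x) / (t * t))"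
    by (rule ext) (simp add: add.assoc add.commute[of "_ *\<^sub>R k"])
  then show ?thesis
    using tendsto_unique[OF _ lim[of h k] ] lim[of k h] by auto
qed

text \<open>The radial derivative \<open>x \<bullet> Df\<close>, free of coordinates: the base point
  itself serves as the direction.\<close>

definition euler :: "('a::real_normed_vector \<Rightarrow> real) \<Rightarrow> 'a \<Rightarrow> real" where
  "euler f x = dir_deriv x f x"

text \<open>The commutator of \<open>D_h\<close> with the radial derivative is \<open>D_h\<close>:
  the extra term comes from differentiating the coefficient \<open>x\<close>, and the symmetry of
  mixed derivatives identifies the rest.\<close>

lemma euler_has_derivative:
  fixes f :: "'a::euclidean_space \<Rightarrow> real"
  assumes "smooth f"
  shows "(euler f has_derivative (\<lambda>h. dir_deriv h f x + euler (dir_deriv h f) x)) (at x)"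
proof -
  have eq: "euler f = (\<lambda>x. \<Sum>b\<in>Basis. (x \<bullet> b) * dir_deriv b f x)"
    unfolding euler_def by (rule ext, subst dir_deriv_sum_Basis[OF assms]) simp
  have "((\<lambda>x. \<Sum>b\<in>Basis. (x \<bullet> b) * dir_deriv b f x) has_derivative
    (\<lambda>h. \<Sum>b\<in>Basis. (x \<bullet> b) * dir_deriv h (dir_deriv b f) x + (h \<bullet> b) * dir_deriv b f x)) (at x)"
    by (intro has_derivative_sum has_derivative_mult smooth_has_derivative smooth_dir_deriv assms)
       (auto intro!: derivative_eq_intros)
  moreover have "(\<Sum>b\<in>Basis. (x \<bullet> b) * dir_deriv h (dir_deriv b f) x + (h \<bullet> b) * dir_deriv b f x)
     = dir_deriv h f x + euler (dir_deriv h f) x" for h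
    unfolding euler_def
    by (subst dir_deriv_sum_Basis[OF assms, of h],
        subst dir_deriv_sum_Basis[OF smooth_dir_deriv[OF assms], of x])
       (simp add: sum.distrib dir_deriv_commute[OF assms, of h])
  ultimately show ?thesis unfolding eq by simp
qed

lemma dir_deriv_add_scaleR:
  fixes f :: "'a::euclidean_space \<Rightarrow> real"
  assumes "smooth f"
  shows "dir_deriv (h + k) f = (\<lambda>x. dir_deriv h f x + dir_deriv k f x)"
    and "dir_deriv (c *\<^sub>R h) f = (\<lambda>x. c * dir_deriv h f x)"
  using linear_add[OF dir_deriv_linear[OF assms]] linear_scale[OF dir_deriv_linear[OF assms]]
  by auto

lemma bilinear_second_dir_deriv:
  fixes f :: "'a::euclidean_space \<Rightarrow> real"
  assumes "smooth f"
  shows "bilinear (\<lambda>h k. dir_deriv h (dir_deriv k f) x)"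
proof -
  have "linear (\<lambda>h. dir_deriv h (dir_deriv k f) x)" for k
    by (intro dir_deriv_linear smooth_dir_deriv assms)
  moreover have "(\<lambda>k. dir_deriv h (dir_deriv k f) x) = (\<lambda>k. dir_deriv k (dir_deriv h f) x)" for h
    by (rule ext) (rule dir_deriv_commute[OF assms])
  moreover have "linear (\<lambda>k. dir_deriv k (dir_deriv h f) x)" for h
    by (intro dir_deriv_linear smooth_dir_deriv assms)
  ultimately show ?thesis unfolding bilinear_def by simp
qed

section \<open>Hermitian forms and orthonormal frames\<close>

definition hform :: "complex ^ 'm ^ 'm \<Rightarrow> complex ^ 'm \<Rightarrow> complex ^ 'm::finite \<Rightarrow> complex" where
  "hform A \<xi> \<eta> = (\<Sum>i\<in>UNIV. \<Sum>j\<in>UNIV. A $ i $ j * \<xi> $ i * cnj (\<eta> $ j))"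

definition hermitian :: "complex ^ 'm ^ 'm \<Rightarrow> bool" where
  "hermitian A \<longleftrightarrow> (\<forall>i j. A $ j $ i = cnj (A $ i $ j))"

definition posdef :: "complex ^ 'm ^ 'm::finite \<Rightarrow> bool" where
  "posdef A \<longleftrightarrow> hermitian A \<and> (\<forall>\<xi>. \<xi> \<noteq> 0 \<longrightarrow> Re (herm_form A \<xi>) > 0)"

definition cinner :: "complex ^ 'm \<Rightarrow> complex ^ 'm::finite \<Rightarrow> complex" where
  "cinner \<xi> \<eta> = (\<Sum>i\<in>UNIV. \<xi> $ i * cnj (\<eta> $ i))"

text \<open>The index type is that of the coordinates, so such a family has full size and is a
  basis, as \<open>frame_expand\<close> shows.\<close>

definition frame :: "complex ^ 'm ^ 'm \<Rightarrow> ('m \<Rightarrow> complex ^ 'm::finite) \<Rightarrow> bool" where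
  "frame A w \<longleftrightarrow> (\<forall>i j. hform A (w i) (w j) = (if i = j then 1 else 0))"

lemma herm_form_eq_hform: "herm_form A \<xi> = hform A \<xi> \<xi>"
  by (simp add: herm_form_def hform_def)

lemma hform_add_left: "hform A (\<xi> + \<eta>) \<zeta> = hform A \<xi> \<zeta> + hform A \<eta> \<zeta>"
  by (simp add: hform_def algebra_simps sum.distrib)

lemma hform_add_right: "hform A \<zeta> (\<xi> + \<eta>) = hform A \<zeta> \<xi> + hform A \<zeta> \<eta>"
  by (simp add: hform_def algebra_simps sum.distrib)

lemma hform_diff_left: "hform A (\<xi> - \<eta>) \<zeta> = hform A \<xi> \<zeta> - hform A \<eta> \<zeta>"
  by (simp add: hform_def algebra_simps sum_subtractf)

lemma hform_diff_right: "hform A \<zeta> (\<xi> - \<eta>) = hform A \<zeta> \<xi> - hform A \<zeta> \<eta>"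
  by (simp add: hform_def algebra_simps sum_subtractf)

lemma hform_scale_left: "hform A (c *s \<xi>) \<zeta> = c * hform A \<xi> \<zeta>"
  by (simp add: hform_def algebra_simps sum_distrib_left)

lemma hform_scale_right: "hform A \<zeta> (c *s \<xi>) = cnj c * hform A \<zeta> \<xi>"
  by (simp add: hform_def algebra_simps sum_distrib_left)

lemma hform_zero [simp]: "hform A 0 \<zeta> = 0" "hform A \<zeta> 0 = 0"
  by (simp_all add: hform_def)

lemma hform_sum_left: "hform A (\<Sum>k\<in>S. f k) \<zeta> = (\<Sum>k\<in>S. hform A (f k) \<zeta>)"
  by (induction S rule: infinite_finite_induct) (auto simp: hform_add_left)

lemma hform_sum_right: "hform A \<zeta> (\<Sum>k\<in>S. f k) = (\<Sum>k\<in>S. hform A \<zeta> (f k))"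
  by (induction S rule: infinite_finite_induct) (auto simp: hform_add_right)

lemma hform_commute:
  assumes "hermitian A" shows "hform A \<eta> \<xi> = cnj (hform A \<xi> \<eta>)"
proof -
  have cA: "cnj (A $ i $ j) = A $ j $ i" for i j using assms unfolding hermitian_def by metis
  have "cnj (hform A \<xi> \<eta>) = (\<Sum>i\<in>UNIV. \<Sum>j\<in>UNIV. A $ j $ i * cnj (\<xi> $ i) * \<eta> $ j)"
    by (simp add: hform_def cA)
  also have "\<dots> = hform A \<eta> \<xi>"
    unfolding hform_def by (subst sum.swap) (simp add: algebra_simps)
  finally show ?thesis by simp
qed

lemma hform_mat: "hform (mat c) \<xi> \<eta> = c * cinner \<xi> \<eta>"
proof -
  have "hform (mat c) \<xi> \<eta> = (\<Sum>i\<in>UNIV. \<Sum>j\<in>UNIV. if i = j then c * \<xi> $ i * cnj (\<eta> $ j) else 0)"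
    unfolding hform_def mat_def by (intro sum.cong) auto
  then show ?thesis by (simp add: cinner_def sum_distrib_left mult.assoc)
qed

lemma Re_cinner: "Re (cinner \<xi> \<eta>) = \<xi> \<bullet> \<eta>"
  by (simp add: cinner_def inner_vec_def inner_complex_def)

lemma Im_cinner: "Im (cinner \<xi> \<eta>) = \<xi> \<bullet> (\<i> *s \<eta>)"
  by (simp add: cinner_def inner_vec_def inner_complex_def algebra_simps)

lemma norm_cinner_sq: "(cmod (cinner \<xi> \<eta>))\<^sup>2 = (\<xi> \<bullet> \<eta>)\<^sup>2 + (\<xi> \<bullet> (\<i> *s \<eta>))\<^sup>2"
  by (simp add: cmod_power2 Re_cinner Im_cinner)

lemma norm_i_scale: "norm (\<i> *s \<xi>) = norm \<xi>"
  by (simp add: norm_vec_def norm_mult)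

lemma cinner_self: "cinner \<xi> \<xi> = complex_of_real ((norm \<xi>)\<^sup>2)"
  by (simp add: cinner_def norm_vec_def L2_set_def sum_nonneg complex_norm_square del: of_real_power)

lemma cinner_commute: "cinner \<eta> \<xi> = cnj (cinner \<xi> \<eta>)"
  by (simp add: cinner_def mult.commute)

lemma cinner_sum_left: "cinner (\<Sum>k\<in>S. f k) \<zeta> = (\<Sum>k\<in>S. cinner (f k) \<zeta>)"
  using hform_sum_left[of "mat 1"] by (simp add: hform_mat)

lemma cinner_scale_left: "cinner (c *s \<xi>) \<zeta> = c * cinner \<xi> \<zeta>"
  using hform_scale_left[of "mat 1"] by (simp add: hform_mat)

lemma cinner_scale_right: "cinner \<zeta> (c *s \<xi>) = cnj c * cinner \<zeta> \<xi>"
  using hform_scale_right[of "mat 1"] by (simp add: hform_mat)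

lemma cinner_diff_left: "cinner (\<xi> - \<eta>) \<zeta> = cinner \<xi> \<zeta> - cinner \<eta> \<zeta>"
  using hform_diff_left[of "mat 1"] by (simp add: hform_mat)

lemma cmod_cinner_le: "cmod (cinner \<xi> \<eta>) \<le> norm \<xi> * norm \<eta>"
proof -
  have "cmod (cinner \<xi> \<eta>) \<le> (\<Sum>i\<in>UNIV. norm (\<xi> $ i) * norm (\<eta> $ i))"
    unfolding cinner_def by (rule order_trans[OF norm_sum]) (simp add: norm_mult)
  also have "\<dots> \<le> norm \<xi> * norm \<eta>"
    unfolding norm_vec_def using L2_set_mult_ineq[of "\<lambda>i. norm (\<xi> $ i)" "\<lambda>i. norm (\<eta> $ i)" UNIV] by simp
  finally show ?thesis .
qed

lemma posdef_frame_exists: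
  fixes A :: "complex ^ 'm ^ 'm::finite"
  assumes "posdef A"
  shows "\<exists>w. frame A w"
proof -
  have h: "hermitian A" and pos: "\<And>\<xi>. \<xi> \<noteq> 0 \<Longrightarrow> Re (herm_form A \<xi>) > 0"
    using assms by (auto simp: posdef_def)
  have "\<exists>w. (\<forall>i\<in>S. \<forall>j\<in>S. hform A (w i) (w j) = (if i = j then 1 else 0)) \<and> (\<forall>i\<in>S. \<forall>j. j \<notin> S \<longrightarrow> w i $ j = 0)"
    if "finite S" for S :: "'m set"
    using that
  proof (induction S rule: finite_induct)
    case (insert k S)
    then obtain w where w: "\<And>i j. i \<in> S \<Longrightarrow> j \<in> S \<Longrightarrow> hform A (w i) (w j) = (if i = j then 1 else 0)"
      "\<And>i j. i \<in> S \<Longrightarrow> j \<notin> S \<Longrightarrow> w i $ j = 0" by blast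
    txt \<open>Gram--Schmidt; the support condition in the claim guarantees \<open>u \<noteq> 0\<close>.\<close>
    define u where "u = axis k 1 - (\<Sum>i\<in>S. hform A (axis k 1) (w i) *s w i)"
    have uj: "u $ j = axis k 1 $ j" if "j \<notin> S" for j
      using w(2) that by (simp add: u_def)
    have "u $ k = 1" using uj[of k] insert by (simp add: axis_def)
    then have "u \<noteq> 0" by (metis zero_index zero_neq_one)
    define r where "r = Re (herm_form A u)"
    have r: "r > 0" "hform A u u = of_real r"
      using pos[OF \<open>u \<noteq> 0\<close>] hform_commute[OF h, of u u]
      by (auto simp: r_def herm_form_eq_hform complex_eq_iff)
    have ortho: "hform A u (w j) = 0" if "j \<in> S" for j
    proof -
      have "(\<Sum>i\<in>S. hform A (axis k 1) (w i) * hform A (w i) (w j))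
         = (\<Sum>i\<in>S. if i = j then hform A (axis k 1) (w i) else 0)"
        using that w(1) by (intro sum.cong) auto
      then show ?thesis using that insert(1)
        by (simp add: u_def hform_diff_left hform_sum_left hform_scale_left)
    qed
    then have ortho': "hform A (w j) u = 0" if "j \<in> S" for j
      using that hform_commute[OF h, of "w j" u] by simp
    define e where "e = complex_of_real (1 / sqrt r) *s u"
    have ee: "hform A e e = 1"
      using r by (simp add: e_def hform_scale_left hform_scale_right flip: of_real_mult)
    have "hform A e (w j) = 0" "hform A (w j) e = 0" if "j \<in> S" for j
      using ortho[OF that] ortho'[OF that] by (simp_all add: e_def hform_scale_left hform_scale_right)
    moreover have "e $ j = 0" if "j \<notin> insert k S" for j
      using uj[of j] that by (simp add: e_def axis_def)
    ultimately show ?case using w ee insert(2)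
      by (intro exI[of _ "w(k := e)"]) auto
  qed auto
  from this[of UNIV] show ?thesis by (auto simp: frame_def)
qed

section \<open>Frames as congruences, and bounds for the inverse form\<close>

definition ctranspose :: "complex ^ 'm ^ 'm::finite \<Rightarrow> complex ^ 'm ^ 'm" where
  "ctranspose W = (\<chi> i j. cnj (W $ j $ i))"

lemma congruence_component:
  "((\<chi> i. w i) ** B ** ctranspose (\<chi> i. w i)) $ i $ j = hform B (w i) (w j)"
  unfolding matrix_matrix_mult_def hform_def ctranspose_def
  by (simp add: sum_distrib_right) (subst sum.swap, simp add: mult_ac)

lemma det_ctranspose: "det (ctranspose W) = cnj (det W)"
proof -
  have "det (ctranspose W) = det (transpose (ctranspose W))" by simp
  also have "\<dots> = cnj (det W)"
    by (simp add: det_def ctranspose_def transpose_def)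
  finally show ?thesis .
qed

lemma det_congruence:
  "det ((\<chi> i. w i) ** B ** ctranspose (\<chi> i. w i)) = of_real ((cmod (det (\<chi> i. w i)))\<^sup>2) * det B"
  by (simp add: det_mul det_ctranspose complex_norm_square mult_ac del: of_real_power)

lemma frame_congruence:
  "frame A w \<Longrightarrow> (\<chi> i. w i) ** A ** ctranspose (\<chi> i. w i) = mat 1"
  by (simp add: vec_eq_iff congruence_component frame_def mat_def)

lemma det_frame:
  assumes "frame A w"
  shows "of_real ((cmod (det (\<chi> i. w i)))\<^sup>2) * det A = 1" "cmod (det (\<chi> i. w i)) > 0"
proof -
  show *: "of_real ((cmod (det (\<chi> i. w i)))\<^sup>2) * det A = 1"
    unfolding det_congruence[symmetric] frame_congruence[OF assms] by simp
  then show "cmod (det (\<chi> i. w i)) > 0" by auto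
qed

text \<open>For square matrices the right inverse \<open>A ** ctranspose W\<close> of
  \<open>W\<close> is also a left inverse; applied to the row vector \<open>\<xi>\<close> this is
  the expansion.\<close>

lemma frame_expand:
  assumes "frame A w"
  shows "(\<Sum>k\<in>UNIV. hform A \<xi> (w k) *s w k) = \<xi>"
proof -
  let ?W = "\<chi> i. w i"
  have "?W ** (A ** ctranspose ?W) = mat 1"
    using frame_congruence[OF assms] by (simp add: matrix_mul_assoc)
  then have "A ** ctranspose ?W ** ?W = mat 1"
    using matrix_left_right_inverse by blast
  then have 1: "(\<xi> v* (A ** ctranspose ?W)) v* ?W = \<xi>"
    by (simp add: vector_matrix_mul_assoc)
  have 2: "(\<xi> v* (A ** ctranspose ?W)) $ k = hform A \<xi> (w k)" for k
    unfolding vector_matrix_mult_def matrix_matrix_mult_def hform_def ctranspose_def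
    by (simp add: sum_distrib_right sum_distrib_left mult_ac)
  show ?thesis
    by (subst (2) 1[symmetric]) (simp add: vec_eq_iff vector_matrix_mult_def[of _ ?W] 2 mult.commute)
qed

lemma frame_parseval:
  assumes "frame A w" "hermitian A"
  shows "Re (herm_form A \<xi>) = (\<Sum>k\<in>UNIV. (cmod (hform A \<xi> (w k)))\<^sup>2)"
proof -
  have "herm_form A \<xi> = hform A \<xi> (\<Sum>k\<in>UNIV. hform A \<xi> (w k) *s w k)"
    by (simp add: herm_form_eq_hform frame_expand[OF assms(1)])
  also have "\<dots> = of_real (\<Sum>k\<in>UNIV. (cmod (hform A \<xi> (w k)))\<^sup>2)"
    by (simp add: hform_sum_right hform_scale_right complex_norm_square mult.commute del: of_real_power)
  finally show ?thesis by (metis Re_complex_of_real)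
qed

lemma herm_form_frame_comb:
  assumes "frame A w"
  shows "herm_form A (\<Sum>k\<in>UNIV. c k *s w k) = of_real (\<Sum>k\<in>UNIV. (cmod (c k))\<^sup>2)"
proof -
  have "hform A (\<Sum>k\<in>UNIV. c k *s w k) (w l) = c l" for l
  proof -
    have "hform A (\<Sum>k\<in>UNIV. c k *s w k) (w l) = (\<Sum>k\<in>UNIV. if k = l then c k else 0)"
      using assms unfolding hform_sum_left hform_scale_left frame_def by (intro sum.cong) auto
    then show ?thesis by simp
  qed
  then show ?thesis
    by (simp add: herm_form_eq_hform hform_sum_right hform_scale_right complex_norm_square mult.commute del: of_real_power)
qed

text \<open>Up to conjugation the sum is the quadratic form of the inverse of \<open>A\<close>, so
  this is the inverse being at most \<open>1 / \<kappa>\<close>. The vector \<open>\<xi>\<close>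
  stands for the inverse applied to \<open>\<zeta>\<close>: its pairing with \<open>\<zeta>\<close>
  and its own \<open>A\<close>-form both equal \<open>s\<close>, and Cauchy-Schwarz closes the
  loop.\<close>

lemma frame_cinner_upper:
  assumes "frame A w" "\<kappa> > 0" "\<And>\<xi>. \<kappa> * (norm \<xi>)\<^sup>2 \<le> Re (herm_form A \<xi>)"
  shows "(\<Sum>k\<in>UNIV. (cmod (cinner \<zeta> (w k)))\<^sup>2) \<le> (norm \<zeta>)\<^sup>2 / \<kappa>"
proof -
  define \<xi> where "\<xi> = (\<Sum>k\<in>UNIV. cinner \<zeta> (w k) *s w k)"
  define s where "s = (\<Sum>k\<in>UNIV. (cmod (cinner \<zeta> (w k)))\<^sup>2)"
  have s0: "s \<ge> 0" by (simp add: s_def sum_nonneg)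
  have "cinner \<xi> \<zeta> = of_real s"
    by (simp add: \<xi>_def s_def cinner_sum_left cinner_scale_left complex_norm_square cinner_commute[of "w _" \<zeta>]
        del: of_real_power)
  then have "s \<le> norm \<xi> * norm \<zeta>" using cmod_cinner_le[of \<xi> \<zeta>] s0 by simp
  then have "s\<^sup>2 \<le> (norm \<xi>)\<^sup>2 * (norm \<zeta>)\<^sup>2" using s0 by (metis power_mono power_mult_distrib)
  then have "\<kappa> * s\<^sup>2 \<le> (\<kappa> * (norm \<xi>)\<^sup>2) * (norm \<zeta>)\<^sup>2"
    using assms(2) by (simp add: mult.assoc)
  also have "\<kappa> * (norm \<xi>)\<^sup>2 \<le> s"
    using assms(3)[of \<xi>] herm_form_frame_comb[OF assms(1), of "\<lambda>k. cinner \<zeta> (w k)"]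
    by (simp add: \<xi>_def s_def)
  finally have "s * (\<kappa> * s) \<le> s * (norm \<zeta>)\<^sup>2"
    by (simp add: power2_eq_square mult_ac mult_right_mono)
  then have "\<kappa> * s \<le> (norm \<zeta>)\<^sup>2 \<or> s = 0" using s0 by (auto simp: mult_le_cancel_left)
  then show ?thesis using assms(2) unfolding s_def[symmetric] by (auto simp: field_simps)
qed

text \<open>The dual bound, the inverse being at least \<open>1 / \<Lambda>\<close>. Expanding one
  factor of \<open>cinner \<zeta> \<zeta>\<close> in the frame, Cauchy-Schwarz separates the
  coefficients, which \<open>frame_parseval\<close> controls, from the sum in question.\<close>

lemma frame_cinner_lower:
  assumes "frame A w" "hermitian A" "\<And>\<xi>. Re (herm_form A \<xi>) \<le> \<Lambda> * (norm \<xi>)\<^sup>2"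
  shows "(norm \<zeta>)\<^sup>2 \<le> \<Lambda> * (\<Sum>k\<in>UNIV. (cmod (cinner \<zeta> (w k)))\<^sup>2)"
proof (cases "\<zeta> = 0")
  case True then show ?thesis by (simp add: cinner_def)
next
  case False
  define s where "s = (\<Sum>k\<in>UNIV. (cmod (cinner \<zeta> (w k)))\<^sup>2)"
  define a where "a = (\<Sum>k\<in>UNIV. (cmod (hform A \<zeta> (w k)))\<^sup>2)"
  have a: "a \<le> \<Lambda> * (norm \<zeta>)\<^sup>2" using assms(3)[of \<zeta>] by (simp add: a_def frame_parseval[OF assms(1,2)])
  have "of_real ((norm \<zeta>)\<^sup>2) = cinner (\<Sum>k\<in>UNIV. hform A \<zeta> (w k) *s w k) \<zeta>"
    by (simp add: frame_expand[OF assms(1)] cinner_self)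
  also have "\<dots> = (\<Sum>k\<in>UNIV. hform A \<zeta> (w k) * cinner (w k) \<zeta>)"
    by (simp add: cinner_sum_left cinner_scale_left)
  finally have "(norm \<zeta>)\<^sup>2 = cmod (\<Sum>k\<in>UNIV. hform A \<zeta> (w k) * cinner (w k) \<zeta>)"
    by (metis norm_of_real abs_of_nonneg zero_le_power2)
  also have "\<dots> \<le> (\<Sum>k\<in>UNIV. \<bar>cmod (hform A \<zeta> (w k))\<bar> * \<bar>cmod (cinner \<zeta> (w k))\<bar>)"
    by (rule order_trans[OF norm_sum]) (simp add: norm_mult cinner_commute[of "w _" \<zeta>])
  also have "\<dots> \<le> sqrt a * sqrt s"
    using L2_set_mult_ineq[of "\<lambda>k. cmod (hform A \<zeta> (w k))" "\<lambda>k. cmod (cinner \<zeta> (w k))" UNIV]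
    by (simp add: L2_set_def a_def s_def)
  finally have "((norm \<zeta>)\<^sup>2)\<^sup>2 \<le> (sqrt a * sqrt s)\<^sup>2" by (intro power_mono) auto
  also have "\<dots> = a * s" by (simp add: power_mult_distrib a_def s_def sum_nonneg)
  also have "\<dots> \<le> (\<Lambda> * (norm \<zeta>)\<^sup>2) * s" using a by (intro mult_right_mono) (auto simp: s_def sum_nonneg)
  finally have "(norm \<zeta>)\<^sup>2 * (norm \<zeta>)\<^sup>2 \<le> (norm \<zeta>)\<^sup>2 * (\<Lambda> * s)" by (simp add: power2_eq_square mult_ac)
  moreover have "(norm \<zeta>)\<^sup>2 > 0" using False by simp
  ultimately show ?thesis unfolding s_def by (rule mult_left_le_imp_le)
qed

lemma norm_sq_axis: "(norm \<xi>)\<^sup>2 = (\<Sum>j\<in>UNIV. (cmod (cinner (axis j 1) \<xi>))\<^sup>2)"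
proof -
  have "cinner (axis j 1) \<xi> = cnj (\<xi> $ j)" for j
    by (simp add: cinner_def axis_def if_distrib[of "\<lambda>x. x * _"] cong: if_cong)
  then show ?thesis by (simp add: norm_vec_def L2_set_def sum_nonneg)
qed

lemma norm_sq_diff_proj:
  assumes "norm n = 1"
  shows "(norm (\<xi> - cinner \<xi> n *s n))\<^sup>2 = (norm \<xi>)\<^sup>2 - (cmod (cinner \<xi> n))\<^sup>2"
proof -
  let ?c = "cinner \<xi> n"
  have nn: "cinner n n = 1" using assms by (simp add: cinner_self)
  have cx: "cinner n \<xi> = cnj ?c" by (rule cinner_commute)
  have r: "cinner \<zeta> (\<xi> - ?c *s n) = cinner \<zeta> \<xi> - cnj ?c * cinner \<zeta> n" for \<zeta>
    using hform_diff_right[of "mat 1" \<zeta> \<xi> "?c *s n"] by (simp add: hform_mat cinner_scale_right)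
  have "cinner (\<xi> - ?c *s n) (\<xi> - ?c *s n) = cinner \<xi> \<xi> - ?c * cnj ?c"
    by (simp add: r cinner_diff_left cinner_scale_left nn cx algebra_simps)
  then have "complex_of_real ((norm (\<xi> - ?c *s n))\<^sup>2) = of_real ((norm \<xi>)\<^sup>2 - (cmod ?c)\<^sup>2)"
    by (simp only: cinner_self complex_norm_square of_real_diff)
  then show ?thesis by (simp only: of_real_eq_iff)
qed

text \<open>This is the trace of the inverse form over the complex orthogonal complement of
  \<open>n\<close>. The self-adjoint projection \<open>P\<close> can be moved onto the coordinate
  axes, whose projections have squared lengths adding up to m - 1 instead of m;
  \<open>norm_supersolution\<close> lives on this saving.\<close>

lemma frame_tangential_upper:
  fixes A :: "complex ^ 'm ^ 'm::finite"
  assumes "frame A w" "\<kappa> > 0" "\<And>\<xi>. \<kappa> * (norm \<xi>)\<^sup>2 \<le> Re (herm_form A \<xi>)" "norm n = 1"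
  shows "(\<Sum>k\<in>UNIV. (norm (w k))\<^sup>2 - (cmod (cinner n (w k)))\<^sup>2) \<le> (real CARD('m) - 1) / \<kappa>"
proof -
  define P where "P \<xi> = \<xi> - cinner \<xi> n *s n" for \<xi>
  have sym: "cinner \<zeta> (P \<xi>) = cinner (P \<zeta>) \<xi>" for \<zeta> \<xi>
  proof -
    have "cinner \<zeta> (P \<xi>) = cinner \<zeta> \<xi> - cnj (cinner \<xi> n) * cinner \<zeta> n"
      using hform_diff_right[of "mat 1" \<zeta> \<xi> "cinner \<xi> n *s n"] by (simp add: P_def hform_mat cinner_scale_right)
    then show ?thesis
      by (simp add: P_def cinner_diff_left cinner_scale_left cinner_commute[of n \<xi>] mult.commute)
  qed
  have np: "(norm (P \<xi>))\<^sup>2 = (norm \<xi>)\<^sup>2 - (cmod (cinner n \<xi>))\<^sup>2" for \<xi>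
    using norm_sq_diff_proj[OF assms(4), of \<xi>] by (simp add: P_def cinner_commute[of n \<xi>])
  have "(\<Sum>k\<in>UNIV. (norm (w k))\<^sup>2 - (cmod (cinner n (w k)))\<^sup>2) = (\<Sum>k\<in>UNIV. (norm (P (w k)))\<^sup>2)"
    by (simp add: np)
  also have "\<dots> = (\<Sum>k\<in>UNIV. \<Sum>j\<in>UNIV. (cmod (cinner (P (axis j 1)) (w k)))\<^sup>2)"
    by (subst norm_sq_axis) (simp add: sym)
  also have "\<dots> = (\<Sum>j\<in>UNIV. \<Sum>k\<in>UNIV. (cmod (cinner (P (axis j 1)) (w k)))\<^sup>2)"
    by (rule sum.swap)
  also have "\<dots> \<le> (\<Sum>j\<in>UNIV. (norm (P (axis j 1)))\<^sup>2 / \<kappa>)"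
    by (intro sum_mono frame_cinner_upper[OF assms(1-3)])
  also have "\<dots> = (\<Sum>j\<in>UNIV. 1 - (cmod (cinner (axis j 1) n))\<^sup>2) / \<kappa>"
    by (simp add: np sum_divide_distrib cinner_commute[of n "axis _ _"])
  also have "\<dots> = (real CARD('m) - (norm n)\<^sup>2) / \<kappa>"
    by (simp add: sum_subtractf norm_sq_axis[of n])
  finally show ?thesis using assms(4) by simp
qed

text \<open>A null vector of a semidefinite Hermitian form lies in its kernel: otherwise the form
  would become negative on leaving the vector along \<open>\<eta>\<close>. A nonzero determinant
  excludes a kernel.\<close>

lemma psd_nondegenerate_posdef:
  fixes A :: "complex ^ 'm ^ 'm::finite"
  assumes h: "hermitian A" and psd: "\<And>\<xi>. Re (herm_form A \<xi>) \<ge> 0" and d: "det A \<noteq> 0"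
  shows "posdef A"
  unfolding posdef_def
proof (intro conjI allI impI h)
  fix \<xi> :: "complex ^ 'm" assume "\<xi> \<noteq> 0"
  show "Re (herm_form A \<xi>) > 0"
  proof (rule ccontr)
    assume "\<not> Re (herm_form A \<xi>) > 0"
    then have z: "Re (hform A \<xi> \<xi>) = 0" using psd[of \<xi>] by (simp add: herm_form_eq_hform)
    have "\<xi> v* A = 0"
    proof -
      define \<eta> where "\<eta> = \<xi> v* A"
      define c where "c = (norm \<eta>)\<^sup>2"
      have he: "hform A \<xi> \<eta> = of_real c"
      proof -
        have "hform A \<xi> \<eta> = cinner \<eta> \<eta>"
        proof -
          have "\<eta> $ j = (\<Sum>i\<in>UNIV. A $ i $ j * \<xi> $ i)" for j
            by (simp add: \<eta>_def vector_matrix_mult_def mult.commute)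
          then have "cinner \<eta> \<eta> = (\<Sum>j\<in>UNIV. \<Sum>i\<in>UNIV. A $ i $ j * \<xi> $ i * cnj (\<eta> $ j))"
            unfolding cinner_def by (simp add: sum_distrib_right)
          then show ?thesis unfolding hform_def by (subst sum.swap) simp
        qed
        then show ?thesis by (simp add: cinner_self c_def)
      qed
      define d where "d = Re (hform A \<eta> \<eta>)"
      have q: "0 \<le> 2 * t * c + t\<^sup>2 * d" for t :: real
      proof -
        have "Re (hform A (\<xi> + of_real t *s \<eta>) (\<xi> + of_real t *s \<eta>)) = 2 * t * c + t\<^sup>2 * d"
          using z he hform_commute[OF h, of \<eta> \<xi>]
          by (simp add: hform_add_left hform_add_right hform_scale_left hform_scale_right d_def power2_eq_square algebra_simps)
        then show ?thesis using psd[of "\<xi> + of_real t *s \<eta>"] by (simp add: herm_form_eq_hform)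
      qed
      have d0: "d \<ge> 0" using psd[of \<eta>] by (simp add: d_def herm_form_eq_hform)
      have "c = 0"
      proof (rule ccontr)
        assume "c \<noteq> 0"
        then have c: "c > 0" by (simp add: c_def)
        \<comment> \<open>The parameter \<open>- c / (d + 1)\<close> is close enough to the
          minimiser of \<open>2 t c + t^2 d\<close> to give a negative value; the summand 1 keeps it
          defined for \<open>d = 0\<close>.\<close>
        have "d + 1 \<noteq> 0" using d0 by simp
        then have "2 * (- c / (d + 1)) * c + (- c / (d + 1))\<^sup>2 * d = c\<^sup>2 * (d - 2 * (d + 1)) / (d + 1)\<^sup>2"
          by (simp add: divide_simps power2_eq_square) algebra
        also have "\<dots> < 0" using c d0 by (intro divide_neg_pos mult_pos_neg) auto
        finally show False using q[of "- c / (d + 1)"] by simp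
      qed
      then show ?thesis by (simp add: c_def \<eta>_def)
    qed
    then have "transpose A *v \<xi> = 0" by simp
    moreover have "invertible (transpose A)" using d by (simp add: invertible_det_nz)
    ultimately have "\<xi> = 0" by (metis matrix_left_invertible_ker invertible_def)
    then show False using \<open>\<xi> \<noteq> 0\<close> by simp
  qed
qed

section \<open>Logarithmic derivative of the determinant\<close>

lemma det_has_vector_derivative_at_identity:
  fixes M :: "real \<Rightarrow> complex ^ 'm ^ 'm::finite"
  assumes "M s = mat 1" "\<And>i j. ((\<lambda>t. M t $ i $ j) has_vector_derivative D $ i $ j) (at s)"
  shows "((\<lambda>t. det (M t)) has_vector_derivative trace D) (at s)"
proof -
  let ?P = "{p. p permutes (UNIV :: 'm set)}"
  have "((\<lambda>t. \<Sum>p\<in>?P. of_int (sign p) * (\<Prod>i\<in>UNIV. M t $ i $ p i)) has_derivative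
     (\<lambda>h. \<Sum>p\<in>?P. of_int (sign p) * (\<Sum>i\<in>UNIV. (h *\<^sub>R D $ i $ p i) * (\<Prod>j\<in>UNIV - {i}. M s $ j $ p j)))) (at s)"
    using assms(2) unfolding has_vector_derivative_def
    by (intro has_derivative_sum has_derivative_mult_right has_derivative_prod) auto
  moreover have "(\<Sum>p\<in>?P. of_int (sign p) * (\<Sum>i\<in>UNIV. (h *\<^sub>R D $ i $ p i) * (\<Prod>j\<in>UNIV - {i}. M s $ j $ p j)))
     = h *\<^sub>R trace D" for h
  proof -
    \<comment> \<open>A permutation other than the identity moves at least two points, so when one
      factor is differentiated, an off-diagonal entry of the identity matrix is still left in the
      product.\<close>
    have z: "(\<Prod>j\<in>UNIV - {i}. M s $ j $ p j) = 0" if "p \<in> ?P" "p \<noteq> id" for p i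
    proof -
      have "\<exists>j\<in>UNIV - {i}. p j \<noteq> j"
      proof (rule ccontr)
        assume "\<not> ?thesis"
        then have f: "p j = j" if "j \<noteq> i" for j using that by auto
        have "inj p" using \<open>p \<in> ?P\<close> permutes_inj by auto
        have "p i = i" using f[of "p i"] \<open>inj p\<close> by (metis injD)
        then have "p = id" using f by (intro ext) (metis id_apply)
        then show False using that by simp
      qed
      then obtain j where "j \<in> UNIV - {i}" "p j \<noteq> j" by blast
      then have "M s $ j $ p j = 0" using assms(1) by (simp add: mat_def)
      then show ?thesis using \<open>j \<in> UNIV - {i}\<close> by (intro prod_zero) auto
    qed
    have "(\<Sum>p\<in>?P. of_int (sign p) * (\<Sum>i\<in>UNIV. (h *\<^sub>R D $ i $ p i) * (\<Prod>j\<in>UNIV - {i}. M s $ j $ p j)))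
      = (\<Sum>p\<in>?P. if p = id then h *\<^sub>R trace D else 0)"
    proof (rule sum.cong[OF refl])
      fix p assume p: "p \<in> ?P"
      show "of_int (sign p) * (\<Sum>i\<in>UNIV. (h *\<^sub>R D $ i $ p i) * (\<Prod>j\<in>UNIV - {i}. M s $ j $ p j))
        = (if p = id then h *\<^sub>R trace D else 0)"
      proof (cases "p = id")
        case True
        have "(\<Prod>j\<in>UNIV - {i}. M s $ j $ p j) = 1" for i
          using True assms(1) by (intro prod.neutral) (auto simp: mat_def)
        then show ?thesis using True by (simp add: sign_id trace_def scaleR_sum_right)
      next
        case False
        then show ?thesis by (simp only: z[OF p False] mult_zero_right sum.neutral_const if_False)
      qed
    qed
    also have "\<dots> = h *\<^sub>R trace D"
      by (subst sum.delta) (auto simp: permutes_id finite_permutations)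
    finally show ?thesis .
  qed
  ultimately show ?thesis unfolding has_vector_derivative_def det_def by simp
qed

text \<open>Jacobi's formula, with the trace of the inverse times \<open>D\<close> written over the
  frame. Congruence by the fixed matrix \<open>W\<close> moves the base point to the identity matrix
  and multiplies every determinant by the same \<open>c\<close>, which cancels in the logarithmic
  derivative.\<close>

lemma ln_det_has_derivative:
  fixes A :: "real \<Rightarrow> complex ^ 'm ^ 'm::finite"
  assumes "frame (A s) w" "\<And>i j. ((\<lambda>t. A t $ i $ j) has_vector_derivative D $ i $ j) (at s)"
  shows "((\<lambda>t. ln (Re (det (A t)))) has_real_derivative (\<Sum>k\<in>UNIV. Re (herm_form D (w k)))) (at s)"
proof -
  define W where "W = (\<chi> i. w i)"
  define c where "c = (cmod (det W))\<^sup>2"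
  have c: "c > 0" using det_frame(2)[OF assms(1)] unfolding c_def W_def by (rule zero_less_power)
  define M where "M t = W ** A t ** ctranspose W" for t
  define E where "E = W ** D ** ctranspose W"
  have Ms: "M s = mat 1" unfolding M_def W_def by (rule frame_congruence[OF assms(1)])
  have "((\<lambda>t. M t $ i $ j) has_vector_derivative E $ i $ j) (at s)" for i j
    unfolding M_def E_def W_def congruence_component hform_def
    by (intro has_vector_derivative_sum bounded_linear.has_vector_derivative[OF bounded_linear_mult_left]
        assms(2))
  from det_has_vector_derivative_at_identity[OF Ms this]
  have "((\<lambda>t. Re (det (M t))) has_vector_derivative Re (trace E)) (at s)"
    by (rule bounded_linear.has_vector_derivative[OF bounded_linear_Re])
  then have d: "((\<lambda>t. Re (det (M t))) has_real_derivative Re (trace E)) (at s)"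
    by (simp add: has_real_derivative_iff_has_vector_derivative)
  have eq: "Re (det (M t)) = c * Re (det (A t))" for t
    unfolding M_def W_def det_congruence c_def by (simp del: of_real_power)
  have "((\<lambda>t. Re (det (A t))) has_real_derivative Re (trace E) / c) (at s)"
    using DERIV_cdivide[OF d, of c] c by (simp add: eq)
  moreover have "c * Re (det (A s)) = 1" using eq[of s] Ms by simp
  then have "Re (det (A s)) = 1 / c" using c by (simp add: field_simps)
  ultimately have "((\<lambda>t. ln (Re (det (A t)))) has_real_derivative Re (trace E)) (at s)"
    using c DERIV_chain2[OF DERIV_ln_divide, of "\<lambda>t. Re (det (A t))" s "Re (trace E) / c" UNIV] by simp
  moreover have "Re (trace E) = (\<Sum>k\<in>UNIV. Re (herm_form D (w k)))"
    unfolding trace_def E_def W_def congruence_component herm_form_eq_hform by simp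
  ultimately show ?thesis by simp
qed

text \<open>Along the segment from \<open>\<kappa> I\<close> to \<open>A\<close> the logarithm of the determinant is nondecreasing.\<close>

lemma det_lower_bound:
  fixes A :: "complex ^ 'm ^ 'm::finite"
  assumes h: "hermitian A" and k: "\<kappa> > 0" and low: "\<And>\<xi>. \<kappa> * (norm \<xi>)\<^sup>2 \<le> Re (herm_form A \<xi>)"
  shows "ln (Re (det A)) \<ge> real CARD('m) * ln \<kappa>"
proof -
  define B where "B s = (\<chi> i j. (1 - of_real s) * (mat (of_real \<kappa>) $ i $ j) + of_real s * A $ i $ j)" for s :: real
  define D where "D = A - mat (of_real \<kappa>)"
  have form: "Re (herm_form (B s) \<xi>) = (1 - s) * (\<kappa> * (norm \<xi>)\<^sup>2) + s * Re (herm_form A \<xi>)" for s \<xi>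
  proof -
    have "hform (B s) \<xi> \<xi> = (1 - of_real s) * hform (mat (of_real \<kappa>)) \<xi> \<xi> + of_real s * hform A \<xi> \<xi>"
      unfolding hform_def B_def by (simp add: algebra_simps sum.distrib sum_distrib_left sum_subtractf)
    then show ?thesis by (simp add: herm_form_eq_hform hform_mat cinner_self del: of_real_power)
  qed
  have pd: "posdef (B s)" if "0 \<le> s" "s \<le> 1" for s
    unfolding posdef_def
  proof (intro conjI allI impI)
    have "cnj (A $ i $ j) = A $ j $ i" for i j using h unfolding hermitian_def by metis
    then show "hermitian (B s)" unfolding hermitian_def B_def mat_def by simp
    fix \<xi> :: "complex ^ 'm" assume "\<xi> \<noteq> 0"
    have "0 < \<kappa> * (norm \<xi>)\<^sup>2" using k \<open>\<xi> \<noteq> 0\<close> by simp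
    also have "\<kappa> * (norm \<xi>)\<^sup>2 = (1 - s) * (\<kappa> * (norm \<xi>)\<^sup>2) + s * (\<kappa> * (norm \<xi>)\<^sup>2)"
      by (simp add: algebra_simps)
    also have "\<dots> \<le> Re (herm_form (B s) \<xi>)"
      unfolding form using low[of \<xi>] that by (intro add_left_mono mult_left_mono) auto
    finally show "Re (herm_form (B s) \<xi>) > 0" .
  qed
  have "ln (Re (det (B 0))) \<le> ln (Re (det (B 1)))"
  proof (rule DERIV_nonneg_imp_nondecreasing[of 0 1])
    fix s :: real assume s: "0 \<le> s" "s \<le> 1"
    obtain w where w: "frame (B s) w" using posdef_frame_exists[OF pd[OF s]] ..
    have "((\<lambda>t. ln (Re (det (B t)))) has_real_derivative (\<Sum>k\<in>UNIV. Re (herm_form D (w k)))) (at s)"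
      by (rule ln_det_has_derivative[where A = B, OF w])
         (auto simp: B_def D_def algebra_simps intro!: derivative_eq_intros)
    moreover have "Re (herm_form D \<xi>) \<ge> 0" for \<xi>
    proof -
      have "hform D \<xi> \<xi> = hform A \<xi> \<xi> - hform (mat (of_real \<kappa>)) \<xi> \<xi>"
        unfolding hform_def D_def by (simp add: algebra_simps sum_subtractf)
      then show ?thesis using low[of \<xi>] by (simp add: herm_form_eq_hform hform_mat cinner_self del: of_real_power)
    qed
    then have "(\<Sum>k\<in>UNIV. Re (herm_form D (w k))) \<ge> 0" by (intro sum_nonneg)
    ultimately show "\<exists>y. ((\<lambda>t. ln (Re (det (B t)))) has_real_derivative y) (at s) \<and> 0 \<le> y" by blast
  qed simp
  moreover have "B 1 = A" by (simp add: B_def vec_eq_iff)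
  moreover have "B 0 = mat (of_real \<kappa>)" by (simp add: B_def vec_eq_iff)
  moreover have "det (mat (of_real \<kappa>) :: complex ^ 'm ^ 'm) = of_real (\<kappa> ^ CARD('m))"
    by (subst det_diagonal) (auto simp: mat_def)
  ultimately show ?thesis using k by (simp add: ln_realpow)
qed

section \<open>The drift Laplacian and its minimum principles\<close>

text \<open>Asks for nothing off the line, and for the first derivative only near 0, so that
  \<open>norm\<close> qualifies away from the origin.\<close>

definition line2 :: "('a::real_normed_vector \<Rightarrow> real) \<Rightarrow> 'a \<Rightarrow> 'a \<Rightarrow> real \<Rightarrow> bool" where
  "line2 f x h q \<longleftrightarrow> (\<exists>g. (\<forall>\<^sub>F s in nhds 0. ((\<lambda>s. f (x + s *\<^sub>R h)) has_real_derivative g s) (at s)) \<and>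
     (g has_real_derivative q) (at 0))"

lemma line2_add_scale:
  assumes "line2 f x h p" "line2 g x h q"
  shows "line2 (\<lambda>y. f y + c * g y) x h (p + c * q)"
proof -
  obtain f' where f': "\<forall>\<^sub>F s in nhds 0. ((\<lambda>s. f (x + s *\<^sub>R h)) has_real_derivative f' s) (at s)"
    "(f' has_real_derivative p) (at 0)" using assms(1) unfolding line2_def by blast
  obtain g' where g': "\<forall>\<^sub>F s in nhds 0. ((\<lambda>s. g (x + s *\<^sub>R h)) has_real_derivative g' s) (at s)"
    "(g' has_real_derivative q) (at 0)" using assms(2) unfolding line2_def by blast
  have "\<forall>\<^sub>F s in nhds 0. ((\<lambda>s. f (x + s *\<^sub>R h) + c * g (x + s *\<^sub>R h)) has_real_derivative (f' s + c * g' s)) (at s)"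
    using f'(1) g'(1) by eventually_elim (auto intro!: derivative_eq_intros)
  moreover have "((\<lambda>s. f' s + c * g' s) has_real_derivative (p + c * q)) (at 0)"
    using f'(2) g'(2) by (auto intro!: derivative_eq_intros)
  ultimately show ?thesis unfolding line2_def by (intro exI[of _ "\<lambda>s. f' s + c * g' s"] conjI)
qed

lemma eventually_line_in_open:
  fixes x h :: "'a::real_normed_vector"
  assumes "open S" "x \<in> S"
  shows "\<forall>\<^sub>F s in nhds 0. x + s *\<^sub>R h \<in> S"
proof -
  have "((\<lambda>s. x + s *\<^sub>R h) \<longlongrightarrow> x + 0 *\<^sub>R h) (nhds 0)" by (intro tendsto_intros filterlim_ident)
  then show ?thesis using topological_tendstoD[OF _ assms(1)] assms(2) by auto
qed

lemma line2_local_min_nonneg: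
  assumes "line2 f x h q" and S: "open S" "x \<in> S" and min: "\<And>y. y \<in> S \<Longrightarrow> f x \<le> f y"
  shows "q \<ge> 0"
proof (rule ccontr)
  assume "\<not> q \<ge> 0"
  then have "q < 0" by simp
  obtain g where g: "\<forall>\<^sub>F s in nhds 0. ((\<lambda>s. f (x + s *\<^sub>R h)) has_real_derivative g s) (at s)"
    "(g has_real_derivative q) (at 0)" using assms(1) unfolding line2_def by blast
  from eventually_line_in_open[OF S] g(1) have "\<forall>\<^sub>F s in nhds 0. ((\<lambda>s. f (x + s *\<^sub>R h)) has_real_derivative g s) (at s) \<and> x + s *\<^sub>R h \<in> S"
    by eventually_elim auto
  then obtain d where d: "d > 0" "\<And>s. \<bar>s\<bar> < d \<Longrightarrow> ((\<lambda>s. f (x + s *\<^sub>R h)) has_real_derivative g s) (at s)"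
    "\<And>s. \<bar>s\<bar> < d \<Longrightarrow> x + s *\<^sub>R h \<in> S"
    unfolding eventually_nhds_metric by (auto simp: dist_real_def)
  have "g 0 = 0"
    using DERIV_local_min[OF d(2)[of 0] d(1)] d min by auto
  obtain e where e: "e > 0" "\<And>s. 0 < s \<Longrightarrow> s < e \<Longrightarrow> g s < 0"
    using DERIV_neg_dec_right[OF g(2) \<open>q < 0\<close>] \<open>g 0 = 0\<close> by auto
  define t where "t = min d e / 2"
  have t: "0 < t" "t < d" "t < e" using d(1) e(1) by (auto simp: t_def)
  have "\<exists>z>0. z < t \<and> f (x + t *\<^sub>R h) - f (x + 0 *\<^sub>R h) = (t - 0) * g z"
    by (rule MVT2[OF \<open>0 < t\<close>]) (use d(2) t in auto)
  then obtain z where z: "0 < z" "z < t" "f (x + t *\<^sub>R h) - f x = t * g z" by auto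
  have "t * g z < 0" using e(2)[of z] z t by (simp add: mult_pos_neg)
  then show False using z(3) min[OF d(3)[of t]] t by auto
qed

text \<open>
  For a frame \<open>w\<close> that is orthonormal with respect to \<open>A\<close>, the value \<open>l\<close> is
  \<open>tr (A\<inverse> H f) - \<onehalf> x \<bullet> Df\<close> at \<open>x\<close>: the inverse matrix is avoided, since \<open>A\<inverse>\<close> is the sum of the
  rank-one matrices given by the \<open>w k\<close>, and \<open>(H f)(\<xi>, \<xi>)\<close> is a quarter of the Laplacian of \<open>f\<close> on the
  complex line through \<open>\<xi>\<close>.
\<close>

definition has_drift_laplacian ::
  "('m \<Rightarrow> complex ^ 'm) \<Rightarrow> (complex ^ 'm::finite \<Rightarrow> real) \<Rightarrow> complex ^ 'm \<Rightarrow> real \<Rightarrow> bool" where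
  "has_drift_laplacian w f x l \<longleftrightarrow> (\<exists>q q' d.
     (\<forall>k. line2 f x (w k) (q k) \<and> line2 f x (\<i> *s w k) (q' k)) \<and>
     ((\<lambda>s. f (x + s *\<^sub>R x)) has_real_derivative d) (at 0) \<and>
     l = (\<Sum>k\<in>UNIV. (q k + q' k) / 4) - d / 2)"

lemma has_drift_laplacian_add_scale:
  assumes "has_drift_laplacian w f x l" "has_drift_laplacian w g x l'"
  shows "has_drift_laplacian w (\<lambda>y. f y + c * g y) x (l + c * l')"
proof -
  obtain p p' d where f: "\<And>k. line2 f x (w k) (p k)" "\<And>k. line2 f x (\<i> *s w k) (p' k)"
     "((\<lambda>s. f (x + s *\<^sub>R x)) has_real_derivative d) (at 0)"
     "l = (\<Sum>k\<in>UNIV. (p k + p' k) / 4) - d / 2"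
    using assms(1) unfolding has_drift_laplacian_def by auto
  obtain q q' e where g: "\<And>k. line2 g x (w k) (q k)" "\<And>k. line2 g x (\<i> *s w k) (q' k)"
     "((\<lambda>s. g (x + s *\<^sub>R x)) has_real_derivative e) (at 0)"
     "l' = (\<Sum>k\<in>UNIV. (q k + q' k) / 4) - e / 2"
    using assms(2) unfolding has_drift_laplacian_def by auto
  have "((\<lambda>s. f (x + s *\<^sub>R x) + c * g (x + s *\<^sub>R x)) has_real_derivative (d + c * e)) (at 0)"
    using f(3) g(3) by (auto intro!: derivative_eq_intros)
  moreover have "l + c * l' = (\<Sum>k\<in>UNIV. ((p k + c * q k) + (p' k + c * q' k)) / 4) - (d + c * e) / 2"
    unfolding f(4) g(4) by (simp add: add_divide_distrib sum.distrib sum_distrib_left algebra_simps)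
  ultimately show ?thesis
    unfolding has_drift_laplacian_def
    by (intro exI[of _ "\<lambda>k. p k + c * q k"] exI[of _ "\<lambda>k. p' k + c * q' k"] exI[of _ "d + c * e"] conjI allI
        line2_add_scale f(1,2) g(1,2))
qed

lemma has_drift_laplacian_local_min_nonneg:
  assumes "has_drift_laplacian w f x l" and S: "open S" "x \<in> S" and min: "\<And>y. y \<in> S \<Longrightarrow> f x \<le> f y"
  shows "l \<ge> 0"
proof -
  obtain q q' d where q: "\<And>k. line2 f x (w k) (q k)" "\<And>k. line2 f x (\<i> *s w k) (q' k)"
     "((\<lambda>s. f (x + s *\<^sub>R x)) has_real_derivative d) (at 0)"
     "l = (\<Sum>k\<in>UNIV. (q k + q' k) / 4) - d / 2"
    using assms(1) unfolding has_drift_laplacian_def by auto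
  obtain e where e: "e > 0" "\<And>s. \<bar>s\<bar> < e \<Longrightarrow> x + s *\<^sub>R x \<in> S"
    using eventually_line_in_open[OF S] unfolding eventually_nhds_metric by (auto simp: dist_real_def)
  have "d = 0"
    using DERIV_local_min[OF q(3) e(1)] e(2) min by auto
  moreover have "q k \<ge> 0" for k by (rule line2_local_min_nonneg[OF q(1) S]) (rule min)
  moreover have "q' k \<ge> 0" for k by (rule line2_local_min_nonneg[OF q(2) S]) (rule min)
  ultimately show ?thesis using q(4) by (simp add: sum_nonneg)
qed

text \<open>As a function of the squared distance, the restriction to a line is \<open>F\<close> of
  a quadratic polynomial, so no square root has to be differentiated and \<open>x = y\<close> is no
  exception.\<close>

lemma line2_radial:
  fixes x y h :: "'a::real_inner"
  assumes F: "\<forall>\<^sub>F t in nhds ((norm (x - y))\<^sup>2). (F has_real_derivative F' t) (at t)"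
    and F': "(F' has_real_derivative F'') (at ((norm (x - y))\<^sup>2))"
  shows "line2 (\<lambda>z. F ((norm (z - y))\<^sup>2)) x h
           (4 * F'' * ((x - y) \<bullet> h)\<^sup>2 + 2 * F' ((norm (x - y))\<^sup>2) * (norm h)\<^sup>2)"
    and "((\<lambda>s. F ((norm (x + s *\<^sub>R h - y))\<^sup>2)) has_real_derivative
           2 * F' ((norm (x - y))\<^sup>2) * ((x - y) \<bullet> h)) (at 0)"
proof -
  define r where "r s = (norm (x - y))\<^sup>2 + 2 * s * ((x - y) \<bullet> h) + s\<^sup>2 * (norm h)\<^sup>2" for s :: real
  have nr: "(norm (x + s *\<^sub>R h - y))\<^sup>2 = r s" for s
    unfolding r_def power2_norm_eq_inner by (simp add: algebra_simps inner_commute power2_eq_square)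
  define r' where "r' s = 2 * ((x - y) \<bullet> h) + 2 * s * (norm h)\<^sup>2" for s :: real
  have dr: "(r has_real_derivative r' s) (at s)" for s
    unfolding r_def r'_def by (auto intro!: derivative_eq_intros)
  have r0: "r 0 = (norm (x - y))\<^sup>2" by (simp add: r_def)
  have "isCont r 0" using dr DERIV_isCont by blast
  then have "filterlim r (nhds (r 0)) (nhds 0)" by (simp add: continuous_at tendsto_nhds_iff)
  with F have "\<forall>\<^sub>F s in nhds 0. (F has_real_derivative F' (r s)) (at (r s))"
    unfolding r0 by (rule eventually_compose_filterlim)
  then have ev: "\<forall>\<^sub>F s in nhds 0. ((\<lambda>s. F (r s)) has_real_derivative F' (r s) * r' s) (at s)"
    by eventually_elim (rule DERIV_chain2[OF _ dr])
  have "((\<lambda>s. F' (r s)) has_real_derivative F'' * r' 0) (at 0)"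
    using F' dr[of 0] by (intro DERIV_chain2) (auto simp: r0)
  then have "((\<lambda>s. F' (r s) * r' s) has_real_derivative
      4 * F'' * ((x - y) \<bullet> h)\<^sup>2 + 2 * F' ((norm (x - y))\<^sup>2) * (norm h)\<^sup>2) (at 0)"
    unfolding r'_def by (auto intro!: derivative_eq_intros simp: r0 power2_eq_square)
  with ev show "line2 (\<lambda>z. F ((norm (z - y))\<^sup>2)) x h
           (4 * F'' * ((x - y) \<bullet> h)\<^sup>2 + 2 * F' ((norm (x - y))\<^sup>2) * (norm h)\<^sup>2)"
    unfolding line2_def nr by (intro exI[of _ "\<lambda>s. F' (r s) * r' s"] conjI)
  have "((\<lambda>s. F (r s)) has_real_derivative F' (r 0) * r' 0) (at 0)"
    using ev eventually_nhds_x_imp_x by blast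
  then show "((\<lambda>s. F ((norm (x + s *\<^sub>R h - y))\<^sup>2)) has_real_derivative
           2 * F' ((norm (x - y))\<^sup>2) * ((x - y) \<bullet> h)) (at 0)"
    unfolding nr r0 by (simp add: r'_def mult_ac)
qed

text \<open>Adding the lines along \<open>w k\<close> and \<open>\<i> *s w k\<close> joins two
  squared real inner products into the squared modulus of the complex one, and the factor 1/4 is
  absorbed.\<close>

lemma has_drift_laplacian_radial:
  fixes x y :: "complex ^ 'm::finite"
  assumes F: "\<forall>\<^sub>F t in nhds ((norm (x - y))\<^sup>2). (F has_real_derivative F' t) (at t)"
    and F': "(F' has_real_derivative F'') (at ((norm (x - y))\<^sup>2))"
  shows "has_drift_laplacian w (\<lambda>z. F ((norm (z - y))\<^sup>2)) x
    (F'' * (\<Sum>k\<in>UNIV. (cmod (cinner (x - y) (w k)))\<^sup>2) + F' ((norm (x - y))\<^sup>2) * (\<Sum>k\<in>UNIV. (norm (w k))\<^sup>2)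
      - F' ((norm (x - y))\<^sup>2) * ((x - y) \<bullet> x))"
proof -
  let ?f = "F' ((norm (x - y))\<^sup>2)"
  let ?q = "\<lambda>h. 4 * F'' * ((x - y) \<bullet> h)\<^sup>2 + 2 * ?f * (norm h)\<^sup>2"
  have "(\<Sum>k\<in>UNIV. (?q (w k) + ?q (\<i> *s w k)) / 4)
    = (\<Sum>k\<in>UNIV. F'' * (cmod (cinner (x - y) (w k)))\<^sup>2 + ?f * (norm (w k))\<^sup>2)"
    by (intro sum.cong refl) (simp add: norm_cinner_sq norm_i_scale algebra_simps)
  then show ?thesis
    unfolding has_drift_laplacian_def
    using line2_radial(1)[OF assms] line2_radial(2)[OF assms, of x]
    by (intro exI[of _ "\<lambda>k. ?q (w k)"] exI[of _ "\<lambda>k. ?q (\<i> *s w k)"] exI[of _ "2 * ?f * ((x - y) \<bullet> x)"])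
       (simp add: sum.distrib sum_distrib_left)
qed

text \<open>\<open>K - U\<close> plays the part of the boundary, so that balls and annuli are
  treated alike. A minimum inside \<open>U\<close> would force \<open>l \<ge> 0\<close>.\<close>

lemma strict_min_principle:
  fixes f :: "complex ^ 'm::finite \<Rightarrow> real"
  assumes K: "compact K" "continuous_on K f" and U: "open U" "U \<subseteq> K"
    and bd: "\<And>x. x \<in> K - U \<Longrightarrow> c \<le> f x"
    and op: "\<And>x. x \<in> U \<Longrightarrow> \<exists>w l. has_drift_laplacian w f x l \<and> l < 0"
    and "x \<in> K"
  shows "c \<le> f x"
proof -
  obtain p where p: "p \<in> K" "\<And>y. y \<in> K \<Longrightarrow> f p \<le> f y"
    using continuous_attains_inf[OF K(1) _ K(2)] \<open>x \<in> K\<close> by blast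
  have "p \<notin> U"
  proof
    assume "p \<in> U"
    then obtain w l where "has_drift_laplacian w f p l" "l < 0" using op by blast
    moreover have "l \<ge> 0"
      by (rule has_drift_laplacian_local_min_nonneg[OF \<open>has_drift_laplacian w f p l\<close> U(1) \<open>p \<in> U\<close>])
         (use p(2) U(2) in blast)
    ultimately show False by simp
  qed
  then show ?thesis using bd[of p] p \<open>x \<in> K\<close> by force
qed

section \<open>Uniform ellipticity on compact sets, barriers, weak and strong minimum
  principles\<close>

lemma continuous_on_herm_form:
  fixes A :: "'a::topological_space \<Rightarrow> complex ^ 'm ^ 'm::finite"
  assumes "continuous_on K A"
  shows "continuous_on (K \<times> S) (\<lambda>z. Re (herm_form (A (fst z)) (snd z)))"
proof -
  have "continuous_on (K \<times> S) (\<lambda>z. A (fst z))"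
    by (rule continuous_on_compose2[OF assms]) (auto intro!: continuous_intros)
  then show ?thesis
    unfolding herm_form_def by (intro continuous_intros) auto
qed

lemma herm_form_scaleR: "herm_form A ((r::real) *\<^sub>R \<xi>) = of_real (r\<^sup>2) * herm_form A \<xi>"
  unfolding herm_form_def sum_distrib_left
  by (intro sum.cong refl) (simp add: scaleR_conv_of_real[of r "_ :: complex"] power2_eq_square)

lemma posdef_uniform_bounds:
  fixes A :: "'a::topological_space \<Rightarrow> complex ^ 'm ^ 'm::finite"
  assumes K: "compact K" "K \<noteq> {}" "continuous_on K A" and pd: "\<And>x. x \<in> K \<Longrightarrow> posdef (A x)"
  obtains \<kappa> \<Lambda> where "\<kappa> > 0" "\<Lambda> > 0"
    "\<And>x \<xi>. x \<in> K \<Longrightarrow> \<kappa> * (norm \<xi>)\<^sup>2 \<le> Re (herm_form (A x) \<xi>)"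
    "\<And>x \<xi>. x \<in> K \<Longrightarrow> Re (herm_form (A x) \<xi>) \<le> \<Lambda> * (norm \<xi>)\<^sup>2"
proof -
  let ?S = "sphere (0 :: complex ^ 'm) 1"
  let ?f = "\<lambda>z. Re (herm_form (A (fst z)) (snd z))"
  have c: "compact (K \<times> ?S)" using K by (intro compact_Times) auto
  have ne: "K \<times> ?S \<noteq> {}" using K by simp
  note cont = continuous_on_herm_form[OF K(3), of ?S]
  obtain a where a: "a \<in> K \<times> ?S" "\<And>z. z \<in> K \<times> ?S \<Longrightarrow> ?f a \<le> ?f z"
    using continuous_attains_inf[OF c ne cont] by blast
  obtain b where b: "b \<in> K \<times> ?S" "\<And>z. z \<in> K \<times> ?S \<Longrightarrow> ?f z \<le> ?f b"
    using continuous_attains_sup[OF c ne cont] by blast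
  have pos: "?f z > 0" if "z \<in> K \<times> ?S" for z
  proof -
    have "snd z \<noteq> 0" using that by (auto simp: mem_Times_iff)
    then show ?thesis using that pd[of "fst z"] unfolding posdef_def by (auto simp: mem_Times_iff)
  qed
  have scale: "Re (herm_form (A x) \<xi>) = (norm \<xi>)\<^sup>2 * ?f (x, \<xi> /\<^sub>R norm \<xi>)" if "\<xi> \<noteq> 0" for x \<xi>
    using that by (simp add: herm_form_scaleR power_inverse del: of_real_power)
  have *: "?f a * (norm \<xi>)\<^sup>2 \<le> Re (herm_form (A x) \<xi>)" "Re (herm_form (A x) \<xi>) \<le> ?f b * (norm \<xi>)\<^sup>2"
    if "x \<in> K" for x \<xi>
  proof -
    show "?f a * (norm \<xi>)\<^sup>2 \<le> Re (herm_form (A x) \<xi>)"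
    proof (cases "\<xi> = 0")
      case False
      then have "(x, \<xi> /\<^sub>R norm \<xi>) \<in> K \<times> ?S" using that by simp
      from mult_left_mono[OF a(2)[OF this], of "(norm \<xi>)\<^sup>2"] show ?thesis
        unfolding scale[OF False] by (simp add: mult.commute)
    qed (simp add: herm_form_def)
    show "Re (herm_form (A x) \<xi>) \<le> ?f b * (norm \<xi>)\<^sup>2"
    proof (cases "\<xi> = 0")
      case False
      then have "(x, \<xi> /\<^sub>R norm \<xi>) \<in> K \<times> ?S" using that by simp
      from mult_left_mono[OF b(2)[OF this], of "(norm \<xi>)\<^sup>2"] show ?thesis
        unfolding scale[OF False] by (simp add: mult.commute)
    qed (simp add: herm_form_def)
  qed
  show thesis using that[of "?f a" "?f b"] pos a(1) b(1) * by blast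
qed

lemma frame_norm_le:
  assumes "frame A w" "\<kappa> > 0" "\<And>\<xi>. \<kappa> * (norm \<xi>)\<^sup>2 \<le> Re (herm_form A \<xi>)"
  shows "(norm (w k))\<^sup>2 \<le> 1 / \<kappa>"
proof -
  have "Re (herm_form A (w k)) = 1" using assms(1) by (simp add: frame_def herm_form_eq_hform)
  then show ?thesis using assms(3)[of "w k"] assms(2) by (simp add: field_simps)
qed

text \<open>The operator yields \<open>\<alpha>\<close> times the exponential times
  \<open>\<alpha> S - T + (x - y) \<bullet> x\<close>, where \<open>S\<close> is the inverse form at
  \<open>x - y\<close> and \<open>T\<close> its trace. As \<open>K\<close> keeps away from
  \<open>y\<close>, \<open>S\<close> is bounded below there by a positive number, and a large
  \<open>\<alpha>\<close> wins; compactness makes one \<open>\<alpha>\<close> serve all of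
  \<open>K\<close>.\<close>

lemma exp_barrier:
  fixes A :: "complex ^ 'm \<Rightarrow> complex ^ 'm ^ 'm::finite"
  assumes K: "compact K" "y \<notin> K" "continuous_on K A" and pd: "\<And>x. x \<in> K \<Longrightarrow> posdef (A x)"
  obtains \<alpha> where "\<alpha> > 0"
    "\<And>x w. x \<in> K \<Longrightarrow> frame (A x) w \<Longrightarrow>
       \<exists>l>0. has_drift_laplacian w (\<lambda>z. exp (- \<alpha> * (norm (z - y))\<^sup>2)) x l"
proof (cases "K = {}")
  case True then show ?thesis using that[of 1] by simp
next
  case False
  obtain \<kappa> \<Lambda> where b: "\<kappa> > 0" "\<Lambda> > 0"
    "\<And>x \<xi>. x \<in> K \<Longrightarrow> \<kappa> * (norm \<xi>)\<^sup>2 \<le> Re (herm_form (A x) \<xi>)"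
    "\<And>x \<xi>. x \<in> K \<Longrightarrow> Re (herm_form (A x) \<xi>) \<le> \<Lambda> * (norm \<xi>)\<^sup>2"
    using posdef_uniform_bounds[OF K(1) False K(3) pd] by metis
  have c1: "continuous_on K (\<lambda>x. (norm (x - y))\<^sup>2)" and c2: "continuous_on K (\<lambda>x. (x - y) \<bullet> x)"
    by (intro continuous_intros)+
  obtain a where a: "a \<in> K" "\<And>x. x \<in> K \<Longrightarrow> (norm (a - y))\<^sup>2 \<le> (norm (x - y))\<^sup>2"
    using continuous_attains_inf[OF K(1) False c1] by blast
  obtain c where c: "\<And>x. x \<in> K \<Longrightarrow> (c - y) \<bullet> c \<le> (x - y) \<bullet> x"
    using continuous_attains_inf[OF K(1) False c2] by blast
  define r where "r = (norm (a - y))\<^sup>2"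
  have r: "r > 0" using a(1) K(2) by (auto simp: r_def)
  define M where "M = real CARD('m) / \<kappa> + \<bar>(c - y) \<bullet> c\<bar> + 1"
  have M: "M > 0" using b(1) by (simp add: M_def add_nonneg_pos)
  \<comment> \<open>Gives \<open>\<alpha> S \<ge> M\<close>, because
    \<open>r \<le> \<Lambda> S\<close> on \<open>K\<close>; the summand 1 in \<open>M\<close>
    provides strictness.\<close>
  define \<alpha> where "\<alpha> = M * \<Lambda> / r"
  have \<alpha>: "\<alpha> > 0" using M b r by (simp add: \<alpha>_def)
  have "\<exists>l>0. has_drift_laplacian w (\<lambda>z. exp (- \<alpha> * (norm (z - y))\<^sup>2)) x l"
    if x: "x \<in> K" and w: "frame (A x) w" for x w
  proof -
    let ?e = "exp (- \<alpha> * (norm (x - y))\<^sup>2)"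
    let ?S = "\<Sum>k\<in>UNIV. (cmod (cinner (x - y) (w k)))\<^sup>2"
    let ?T = "\<Sum>k\<in>UNIV. (norm (w k))\<^sup>2"
    have op: "has_drift_laplacian w (\<lambda>z. exp (- \<alpha> * (norm (z - y))\<^sup>2)) x
      (\<alpha>\<^sup>2 * ?e * ?S + (- \<alpha> * ?e) * ?T - (- \<alpha> * ?e) * ((x - y) \<bullet> x))"
      by (rule has_drift_laplacian_radial[where F = "\<lambda>t. exp (- \<alpha> * t)" and F' = "\<lambda>t. - \<alpha> * exp (- \<alpha> * t)"])
         (auto intro!: derivative_eq_intros always_eventually simp: power2_eq_square)
    have "r \<le> (norm (x - y))\<^sup>2" using a(2)[OF x] by (simp add: r_def)
    also have "\<dots> \<le> \<Lambda> * ?S"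
      using pd[OF x] by (intro frame_cinner_lower[OF w]) (auto simp: posdef_def b(4)[OF x])
    finally have "M \<le> \<alpha> * ?S" using r b M by (simp add: \<alpha>_def field_simps)
    moreover have "?T \<le> (\<Sum>k\<in>(UNIV::'m set). 1 / \<kappa>)"
      by (intro sum_mono frame_norm_le[OF w b(1) b(3)[OF x]])
    then have "?T \<le> real CARD('m) / \<kappa>" by simp
    moreover have "(x - y) \<bullet> x \<ge> - \<bar>(c - y) \<bullet> c\<bar>" using c[OF x] by linarith
    ultimately have "\<alpha> * ?S - ?T + (x - y) \<bullet> x > 0" unfolding M_def by linarith
    then have "\<alpha> * ?e * (\<alpha> * ?S - ?T + (x - y) \<bullet> x) > 0" using \<alpha> by simp
    moreover have "\<alpha> * ?e * (\<alpha> * ?S - ?T + (x - y) \<bullet> x)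
       = \<alpha>\<^sup>2 * ?e * ?S + (- \<alpha> * ?e) * ?T - (- \<alpha> * ?e) * ((x - y) \<bullet> x)"
      by (simp add: algebra_simps power2_eq_square)
    ultimately show ?thesis using op by metis
  qed
  then show ?thesis using that[of \<alpha>] \<alpha> by blast
qed

text \<open>Subtracting \<open>e\<close> times the barrier turns a solution into a strict
  supersolution, and since the barrier has values between 0 and 1 this costs at most
  \<open>e\<close>.\<close>

lemma weak_min_principle:
  fixes A :: "complex ^ 'm \<Rightarrow> complex ^ 'm ^ 'm::finite"
  assumes K: "compact K" "y \<notin> K" "continuous_on K A" and pd: "\<And>x. x \<in> K \<Longrightarrow> posdef (A x)"
    and f: "continuous_on K f" "\<And>x w. x \<in> K \<Longrightarrow> frame (A x) w \<Longrightarrow> has_drift_laplacian w f x 0"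
    and U: "open U" "U \<subseteq> K" and bd: "\<And>x. x \<in> K - U \<Longrightarrow> c \<le> f x" and "x \<in> K"
  shows "c \<le> f x"
proof (rule field_le_epsilon)
  fix e :: real assume e: "e > 0"
  obtain \<alpha> where \<alpha>: "\<alpha> > 0"
    "\<And>x w. x \<in> K \<Longrightarrow> frame (A x) w \<Longrightarrow>
       \<exists>l>0. has_drift_laplacian w (\<lambda>z. exp (- \<alpha> * (norm (z - y))\<^sup>2)) x l"
    using exp_barrier[OF K pd] by metis
  let ?b = "\<lambda>z. exp (- \<alpha> * (norm (z - y))\<^sup>2)"
  have "c - e \<le> f x + (- e) * ?b x"
  proof (rule strict_min_principle[OF K(1) _ U _ _ \<open>x \<in> K\<close>])
    show "continuous_on K (\<lambda>z. f z + (- e) * ?b z)" by (intro continuous_intros f)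
    fix z assume z: "z \<in> K - U"
    have "?b z \<le> 1" using \<alpha>(1) by simp
    then have "e * ?b z \<le> e" using e by (simp add: mult_left_le)
    then show "c - e \<le> f z + (- e) * ?b z" using bd[OF z] by simp
  next
    fix z assume "z \<in> U"
    then have z: "z \<in> K" using U by auto
    obtain w where w: "frame (A z) w" using posdef_frame_exists[OF pd[OF z]] ..
    obtain l where l: "l > 0" "has_drift_laplacian w ?b z l" using \<alpha>(2)[OF z w] by blast
    have "has_drift_laplacian w (\<lambda>z. f z + (- e) * ?b z) z (0 + (- e) * l)"
      by (rule has_drift_laplacian_add_scale[OF f(2)[OF z w] l(2)])
    moreover have "0 + (- e) * l < 0" using e l by simp
    ultimately show "\<exists>w l. has_drift_laplacian w (\<lambda>z. f z + (- e) * ?b z) z l \<and> l < 0" by blast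
  qed
  moreover have "e * ?b x \<ge> 0" using e by simp
  ultimately show "c \<le> f x + e" by linarith
qed

text \<open>
  Hopf's argument: the ball about \<open>x\<close> touching the minimum set at \<open>p\<close> yields a barrier on an
  annulus that forces a nonzero radial derivative at \<open>p\<close>.
\<close>

lemma strong_min_principle:
  fixes A :: "complex ^ 'm \<Rightarrow> complex ^ 'm ^ 'm::finite"
  assumes A: "continuous_on UNIV A" and pd: "\<And>x. posdef (A x)"
    and f: "\<And>x. f differentiable (at x)" "\<And>x w. frame (A x) w \<Longrightarrow> has_drift_laplacian w f x 0"
    and min: "\<And>x. f x0 \<le> f x"
  shows "f x = f x0"
proof (rule ccontr)
  assume ne: "f x \<noteq> f x0"
  define m where "m = f x0"
  define Z where "Z = {z. f z = m}"
  have fc: "continuous_on S f" for S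
    using f(1) by (meson continuous_at_imp_continuous_on differentiable_imp_continuous_within)
  have Z: "closed Z" "Z \<noteq> {}"
    unfolding Z_def using continuous_closed_preimage_constant[OF fc[of UNIV] closed_UNIV, of m]
    by (auto simp: m_def)
  obtain p where p: "p \<in> Z" "\<And>z. z \<in> Z \<Longrightarrow> dist x p \<le> dist x z"
    using distance_attains_inf[OF Z] by metis
  define R where "R = dist x p"
  have "x \<noteq> p" using ne p(1) by (auto simp: Z_def m_def)
  then have R: "R > 0" by (simp add: R_def)
  have gt: "f z > m" if "dist x z < R" for z
    using that p(2)[of z] min[of z] unfolding R_def Z_def m_def by force
  define K where "K = cball x R - ball x (R / 2)"
  define U where "U = ball x R - cball x (R / 2)"
  have K: "compact K" "x \<notin> K" unfolding K_def using R by (auto intro: compact_diff)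
  have U: "open U" "U \<subseteq> K" unfolding K_def U_def by auto
  obtain \<alpha> where \<alpha>: "\<alpha> > 0"
    "\<And>z w. z \<in> K \<Longrightarrow> frame (A z) w \<Longrightarrow>
       \<exists>l>0. has_drift_laplacian w (\<lambda>z. exp (- \<alpha> * (norm (z - x))\<^sup>2)) z l"
    using exp_barrier[OF K continuous_on_subset[OF A subset_UNIV] pd] by metis
  let ?b = "\<lambda>z. exp (- \<alpha> * (norm (z - x))\<^sup>2)"
  obtain q where q: "q \<in> cball x (R / 2)" "\<And>z. z \<in> cball x (R / 2) \<Longrightarrow> f q \<le> f z"
    using continuous_attains_inf[OF _ _ fc, of "cball x (R / 2)"] R by auto
  \<comment> \<open>The largest coefficient the inner sphere allows: there
    \<open>f \<ge> m + e\<close>, and the barrier takes away at most \<open>e\<close>.\<close>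
  define e where "e = f q - m"
  have e: "e > 0" using gt[of q] q(1) R by (auto simp: e_def)
  have low: "m - e * exp (- \<alpha> * R\<^sup>2) \<le> f z + (- e) * ?b z" if "z \<in> K" for z
  proof (rule strict_min_principle[OF K(1) _ U _ _ that])
    show "continuous_on K (\<lambda>z. f z + (- e) * ?b z)" by (intro continuous_intros fc)
    fix z assume "z \<in> K - U"
    then consider "dist x z = R" | "dist x z = R / 2" unfolding K_def U_def by force
    then show "m - e * exp (- \<alpha> * R\<^sup>2) \<le> f z + (- e) * ?b z"
    proof cases
      case 1
      then show ?thesis using min[of z] by (simp add: dist_norm norm_minus_commute m_def)
    next
      case 2
      have "?b z \<le> 1" using \<alpha>(1) by simp
      then have "e * ?b z \<le> e" using e by (simp add: mult_left_le)
      moreover have "f z \<ge> m + e" using q(2)[of z] 2 by (simp add: e_def)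
      moreover have "e * exp (- \<alpha> * R\<^sup>2) \<ge> 0" using e by simp
      ultimately show ?thesis by linarith
    qed
  next
    fix z assume "z \<in> U"
    then have z: "z \<in> K" using U by auto
    obtain w where w: "frame (A z) w" using posdef_frame_exists[OF pd] ..
    obtain l where l: "l > 0" "has_drift_laplacian w ?b z l" using \<alpha>(2)[OF z w] by blast
    have "has_drift_laplacian w (\<lambda>z. f z + (- e) * ?b z) z (0 + (- e) * l)"
      by (rule has_drift_laplacian_add_scale[OF f(2)[OF w] l(2)])
    moreover have "0 + (- e) * l < 0" using e l by simp
    ultimately show "\<exists>w l. has_drift_laplacian w (\<lambda>z. f z + (- e) * ?b z) z l \<and> l < 0" by blast
  qed
  define h where "h = x - p"
  have nh: "norm h = R" by (simp add: h_def R_def dist_norm)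
  have df: "((\<lambda>s. f (p + s *\<^sub>R h)) has_real_derivative dir_deriv h f p) (at 0)"
    by (rule has_derivative_line) (simp add: differentiable_has_derivative f(1))
  have "f (p + 0 *\<^sub>R h) \<le> f (p + s *\<^sub>R h)" for s
    using min p(1) by (simp add: Z_def m_def)
  then have "dir_deriv h f p = 0"
    using DERIV_local_min[OF df zero_less_one] by auto
  \<comment> \<open>The comparison function on the segment from \<open>p\<close> to the centre
    \<open>x\<close>, where the squared distance to \<open>x\<close> is
    \<open>(1 - s)^2 R^2\<close>. As \<open>f\<close> has derivative 0 at its minimum
    \<open>p\<close>, the barrier alone decides the slope and makes \<open>g\<close> decrease,
    against \<open>low\<close>.\<close>
  define g where "g s = f (p + s *\<^sub>R h) - e * exp (- \<alpha> * ((1 - s)\<^sup>2 * R\<^sup>2))" for s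
  have "(g has_real_derivative (0 - e * (exp (- \<alpha> * R\<^sup>2) * (2 * \<alpha> * R\<^sup>2)))) (at 0)"
    unfolding g_def using df \<open>dir_deriv h f p = 0\<close>
    by (auto intro!: derivative_eq_intros simp: algebra_simps)
  moreover have "0 - e * (exp (- \<alpha> * R\<^sup>2) * (2 * \<alpha> * R\<^sup>2)) < 0" using e \<alpha>(1) R by simp
  ultimately obtain d where d: "d > 0" "\<And>s. s > 0 \<Longrightarrow> s < d \<Longrightarrow> g (0 + s) < g 0"
    using DERIV_neg_dec_right by blast
  define s where "s = min (d / 2) (1 / 2)"
  have s: "s > 0" "s < d" "s \<le> 1 / 2" using d(1) by (auto simp: s_def)
  have "p + s *\<^sub>R h - x = (s - 1) *\<^sub>R h" by (simp add: h_def algebra_simps)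
  then have n: "norm (p + s *\<^sub>R h - x) = (1 - s) * R" using s by (simp add: nh)
  have "(1 - s) * R \<ge> (1 / 2) * R" "(1 - s) * R \<le> 1 * R"
    using s R by (intro mult_right_mono; simp)+
  then have "p + s *\<^sub>R h \<in> K"
    using n unfolding K_def by (simp add: dist_norm norm_minus_commute)
  from low[OF this] have "m - e * exp (- \<alpha> * R\<^sup>2) \<le> g s"
    unfolding g_def n by (simp add: power_mult_distrib)
  moreover have "g 0 = m - e * exp (- \<alpha> * R\<^sup>2)" using p(1) by (simp add: g_def Z_def)
  ultimately show False using d(2)[OF s(1,2)] by simp
qed

section \<open>The self-shrinker equation\<close>

text \<open>The complex Hessian as a function of the real one. \<open>Q\<close> is left general
  because it will also be the Euler derivative of the second derivatives of
  \<open>v\<close>.\<close>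

definition levi_matrix :: "(complex ^ 'm \<Rightarrow> complex ^ 'm \<Rightarrow> real) \<Rightarrow> complex ^ 'm ^ 'm::finite" where
  "levi_matrix Q = (\<chi> i j.
     (of_real (Q (axis i 1) (axis j 1) + Q (axis i \<i>) (axis j \<i>)) +
      \<i> * of_real (Q (axis i 1) (axis j \<i>) - Q (axis i \<i>) (axis j 1))) / 4)"

lemma hermitian_levi_matrix:
  assumes "\<And>h k. Q h k = Q k h"
  shows "hermitian (levi_matrix Q)"
proof -
  have "cnj (levi_matrix Q $ i $ j) = levi_matrix Q $ j $ i" for i j
    unfolding levi_matrix_def using assms[of "axis i _" "axis j _"]
    by (simp add: assms[of "axis i _" "axis j _"] complex_eq_iff)
  then show ?thesis unfolding hermitian_def by metis
qed

text \<open>Once \<open>\<xi>\<close> is split into its coordinate components, the identity holds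
  term by term. It turns sums over a frame into second derivatives along real lines.\<close>

lemma Re_herm_form_levi_matrix:
  fixes Q :: "complex ^ 'm \<Rightarrow> complex ^ 'm::finite \<Rightarrow> real"
  assumes Q: "bilinear Q"
  shows "Re (herm_form (levi_matrix Q) \<xi>) = (Q \<xi> \<xi> + Q (\<i> *s \<xi>) (\<i> *s \<xi>)) / 4"
proof -
  define p where "p i = axis i (\<xi> $ i)" for i
  have sum_axis: "(\<Sum>i\<in>UNIV. axis i (\<zeta> $ i)) = \<zeta>" for \<zeta> :: "complex ^ 'm"
    by (simp add: vec_eq_iff axis_def)
  have x: "\<xi> = (\<Sum>i\<in>UNIV. p i)" unfolding p_def by (rule sum_axis[symmetric])
  have ix: "\<i> *s \<xi> = (\<Sum>i\<in>UNIV. axis i (\<i> * \<xi> $ i))" using sum_axis[of "\<i> *s \<xi>"] by simp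
  have split: "axis i c = Re c *\<^sub>R axis i 1 + Im c *\<^sub>R axis i \<i>" for c and i :: 'm
    by (simp add: vec_eq_iff axis_def complex_eq_iff)
  have expand: "Q (axis i c) (axis j d) =
      Re c * Re d * Q (axis i 1) (axis j 1) + Re c * Im d * Q (axis i 1) (axis j \<i>)
      + Im c * Re d * Q (axis i \<i>) (axis j 1) + Im c * Im d * Q (axis i \<i>) (axis j \<i>)" for c d i j
    by (subst split[of i c], subst split[of j d],
        simp only: bilinear_ladd[OF Q] bilinear_radd[OF Q] bilinear_lmul[OF Q] bilinear_rmul[OF Q])
       (simp add: algebra_simps)
  have Re_quarter_mult: "Re ((of_real a + \<i> * of_real b) / 4 * y * cnj z)
      = (a * (Re y * Re z + Im y * Im z) - b * (Im y * Re z - Re y * Im z)) / 4" for a b y z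
  proof -
    have "(of_real a + \<i> * of_real b) / 4 * y * cnj z = ((of_real a + \<i> * of_real b) * (y * cnj z)) / 4"
      by simp
    then show ?thesis by (simp only: Re_divide_numeral) (simp add: algebra_simps)
  qed
  have entry: "Re (levi_matrix Q $ i $ j * \<xi> $ i * cnj (\<xi> $ j))
      = (Q (p i) (p j) + Q (axis i (\<i> * \<xi> $ i)) (axis j (\<i> * \<xi> $ j))) / 4" for i j
    unfolding p_def expand[of i "\<xi> $ i" j "\<xi> $ j"] expand[of i "\<i> * \<xi> $ i" j "\<i> * \<xi> $ j"]
    by (simp add: levi_matrix_def Re_quarter_mult del: of_real_add of_real_diff) (simp add: algebra_simps)
  have bsum: "Q (\<Sum>i\<in>UNIV. f i) (\<Sum>j\<in>UNIV. g j) = (\<Sum>i\<in>UNIV. \<Sum>j\<in>UNIV. Q (f i) (g j))"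
    for f g :: "'m \<Rightarrow> complex ^ 'm"
    using bilinear_sum[OF Q, of f UNIV g UNIV] by (simp add: sum.cartesian_product)
  have "Q \<xi> \<xi> = (\<Sum>i\<in>UNIV. \<Sum>j\<in>UNIV. Q (p i) (p j))" unfolding x by (rule bsum)
  moreover have "Q (\<i> *s \<xi>) (\<i> *s \<xi>) = (\<Sum>i\<in>UNIV. \<Sum>j\<in>UNIV. Q (axis i (\<i> * \<xi> $ i)) (axis j (\<i> * \<xi> $ j)))"
    unfolding ix by (rule bsum)
  ultimately show ?thesis
    unfolding herm_form_def Re_sum entry by (simp only: sum.distrib flip: sum_divide_distrib)
qed

lemma dir_deriv_complex_of_real:
  assumes "f differentiable (at x)"
  shows "dir_deriv h (\<lambda>y. complex_of_real (f y)) x = complex_of_real (dir_deriv h f x)"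
  by (rule dir_deriv_eqI)
     (rule bounded_linear.has_derivative[OF bounded_linear_of_real differentiable_has_derivative[OF assms]])

lemma complex_hessian_eq:
  assumes "smooth v"
  shows "complex_hessian v x = levi_matrix (\<lambda>h k. dir_deriv h (dir_deriv k v) x)"
proof -
  have zbar: "d_zbar j (\<lambda>y. complex_of_real (v y))
     = (\<lambda>y. (of_real (dir_deriv (axis j 1) v y) + \<i> * of_real (dir_deriv (axis j \<i>) v y)) / 2)" for j
    by (rule ext) (simp add: d_zbar_def dir_deriv_complex_of_real smooth_differentiable assms)
  have "dir_deriv h (d_zbar j (\<lambda>y. complex_of_real (v y))) x
     = (of_real (dir_deriv h (dir_deriv (axis j 1) v) x) + \<i> * of_real (dir_deriv h (dir_deriv (axis j \<i>) v) x)) / 2" for h j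
    unfolding zbar
    by (rule dir_deriv_eqI)
       (intro bounded_linear.has_derivative[OF bounded_linear_divide] has_derivative_add has_derivative_mult_right
         bounded_linear.has_derivative[OF bounded_linear_of_real] smooth_has_derivative smooth_dir_deriv assms)
  then show ?thesis
    unfolding complex_hessian_def levi_matrix_def d_z_def
    by (simp add: vec_eq_iff algebra_simps add_divide_distrib diff_divide_distrib)
qed

lemma hermitian_complex_hessian: "smooth v \<Longrightarrow> hermitian (complex_hessian v x)"
  by (simp add: complex_hessian_eq hermitian_levi_matrix dir_deriv_commute)

lemma Re_herm_form_complex_hessian:
  assumes "smooth v"
  shows "Re (herm_form (complex_hessian v x) \<xi>) =
    (dir_deriv \<xi> (dir_deriv \<xi> v) x + dir_deriv (\<i> *s \<xi>) (dir_deriv (\<i> *s \<xi>) v) x) / 4"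
  unfolding complex_hessian_eq[OF assms]
  by (rule Re_herm_form_levi_matrix) (rule bilinear_second_dir_deriv[OF assms])

lemma continuous_on_complex_hessian:
  assumes "smooth v" shows "continuous_on S (complex_hessian v)"
proof -
  have "complex_hessian v = (\<lambda>x. levi_matrix (\<lambda>h k. dir_deriv h (dir_deriv k v) x))"
    by (rule ext) (rule complex_hessian_eq[OF assms])
  moreover have "continuous_on S (dir_deriv h (dir_deriv k v))" for h k
    by (intro smooth_continuous smooth_dir_deriv assms)
  ultimately show ?thesis
    unfolding levi_matrix_def by (auto intro!: continuous_intros)
qed

section \<open>From plurisubharmonicity to a semidefinite Hessian\<close>

lemma second_order_taylor:
  fixes f :: "'a::euclidean_space \<Rightarrow> real"
  assumes "smooth f" "r > 0"
  shows "\<exists>t>0. t < r \<and> f (x + r *\<^sub>R h) = f x + r * dir_deriv h f x + r\<^sup>2 / 2 * dir_deriv h (dir_deriv h f) (x + t *\<^sub>R h)"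
proof -
  define D where "D m = (\<lambda>s. (if m = 0 then f else if m = 1 then dir_deriv h f else dir_deriv h (dir_deriv h f)) (x + s *\<^sub>R h))" for m :: nat
  have "\<exists>t>0. t < r \<and> f (x + r *\<^sub>R h) = (\<Sum>m<2. D m 0 / fact m * r ^ m) + D 2 t / fact 2 * r ^ 2"
  proof (rule Maclaurin)
    show "\<forall>m t. m < 2 \<and> 0 \<le> t \<and> t \<le> r \<longrightarrow> (D m has_real_derivative D (Suc m) t) (at t)"
      unfolding D_def using assms(1) by (auto simp: less_2_cases_iff intro!: dir_deriv_line smooth_dir_deriv)
  qed (use assms in \<open>auto simp: D_def\<close>)
  then show ?thesis by (auto simp: D_def lessThan_Suc numeral_2_eq_2 algebra_simps)
qed

text \<open>If the Laplacian \<open>N\<close> on the complex line through \<open>\<xi>\<close> were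
  negative at \<open>a\<close>, Taylor expansion on a small circle would bound \<open>v\<close> by
  the trigonometric polynomial \<open>u\<close>, whose mean \<open>v a + r^2 N / 8\<close> violates
  the sub-mean value inequality.\<close>

lemma plurisubharmonic_hessian_nonneg:
  fixes v :: "complex ^ 'm::finite \<Rightarrow> real"
  assumes v: "smooth v" and psh: "plurisubharmonic v"
  shows "Re (herm_form (complex_hessian v a) \<xi>) \<ge> 0"
proof (rule ccontr)
  define q1 where "q1 = dir_deriv \<xi> (dir_deriv \<xi> v)"
  define q2 where "q2 = dir_deriv \<xi> (dir_deriv (\<i> *s \<xi>) v)"
  define q3 where "q3 = dir_deriv (\<i> *s \<xi>) (dir_deriv (\<i> *s \<xi>) v)"
  define N where "N = q1 a + q3 a"
  define \<alpha> where "\<alpha> = dir_deriv \<xi> v a"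
  define \<beta> where "\<beta> = dir_deriv (\<i> *s \<xi>) v a"
  assume "\<not> 0 \<le> Re (herm_form (complex_hessian v a) \<xi>)"
  then have N: "N < 0" by (simp add: Re_herm_form_complex_hessian[OF v] N_def q1_def q3_def)
  \<comment> \<open>The quadratic part of \<open>u\<close> contributes \<open>r^2 N / 4\<close> to
    its mean. The three second derivatives vary by at most \<open>e\<close> and enter with weights
    at most 1, 2, 1; the resulting error \<open>4 * e\<close> uses up half of that
    contribution.\<close>
  define e where "e = - N / 16"
  have e: "e > 0" using N by (simp add: e_def)
  have near: "\<exists>d>0. \<forall>y. norm (y - a) < d \<longrightarrow> \<bar>q y - q a\<bar> < e" if "continuous_on UNIV q" for q :: "complex ^ 'm \<Rightarrow> real"
    using that e unfolding continuous_on_iff by (auto simp: dist_norm dist_real_def)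
  have cq: "continuous_on UNIV q1" "continuous_on UNIV q2" "continuous_on UNIV q3"
    unfolding q1_def q2_def q3_def by (intro smooth_continuous smooth_dir_deriv v)+
  obtain d1 where d1: "d1 > 0" "\<And>y. norm (y - a) < d1 \<Longrightarrow> \<bar>q1 y - q1 a\<bar> < e" using near[OF cq(1)] by auto
  obtain d2 where d2: "d2 > 0" "\<And>y. norm (y - a) < d2 \<Longrightarrow> \<bar>q2 y - q2 a\<bar> < e" using near[OF cq(2)] by auto
  obtain d3 where d3: "d3 > 0" "\<And>y. norm (y - a) < d3 \<Longrightarrow> \<bar>q3 y - q3 a\<bar> < e" using near[OF cq(3)] by auto
  define r where "r = min d1 (min d2 d3) / (1 + norm \<xi>)"
  have pos: "1 + norm \<xi> > 0" using norm_ge_zero[of \<xi>] by linarith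
  have r: "r > 0" using d1 d2 d3 pos by (simp add: r_def)
  define u where "u \<theta> = v a + r * (cos \<theta> * \<alpha> + sin \<theta> * \<beta>)
    + r\<^sup>2 / 2 * ((cos \<theta>)\<^sup>2 * q1 a + 2 * (cos \<theta> * sin \<theta>) * q2 a + (sin \<theta>)\<^sup>2 * q3 a + 4 * e)" for \<theta>
  have le: "v (a + cis \<theta> *s (r *\<^sub>R \<xi>)) \<le> u \<theta>" for \<theta>
  proof -
    define c s where "c = cos \<theta>" and "s = sin \<theta>"
    define h where "h = c *\<^sub>R \<xi> + s *\<^sub>R (\<i> *s \<xi>)"
    have eq: "cis \<theta> *s (r *\<^sub>R \<xi>) = r *\<^sub>R h"
      by (simp add: vec_eq_iff h_def c_def s_def complex_eq_iff algebra_simps)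
    have nh: "norm h = norm \<xi>"
    proof -
      have "norm (cis \<theta> *s \<xi>) = norm \<xi>" by (simp add: norm_vec_def norm_mult)
      moreover have "cis \<theta> *s \<xi> = h"
        by (simp add: vec_eq_iff h_def c_def s_def complex_eq_iff algebra_simps)
      ultimately show ?thesis by simp
    qed
    have Dh: "dir_deriv h v = (\<lambda>y. c * dir_deriv \<xi> v y + s * dir_deriv (\<i> *s \<xi>) v y)"
      unfolding h_def by (simp add: dir_deriv_add_scaleR[OF v])
    have DDh: "dir_deriv h (dir_deriv h v) y = c\<^sup>2 * q1 y + 2 * (c * s) * q2 y + s\<^sup>2 * q3 y" for y
    proof -
      note B = bilinear_second_dir_deriv[OF v, of y]
      have sym: "dir_deriv (\<i> *s \<xi>) (dir_deriv \<xi> v) y = q2 y"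
        unfolding q2_def by (rule dir_deriv_commute[OF v])
      show ?thesis
        unfolding h_def
        by (simp only: bilinear_ladd[OF B] bilinear_radd[OF B] bilinear_lmul[OF B] bilinear_rmul[OF B] sym
              flip: q1_def q2_def q3_def)
           (simp add: algebra_simps power2_eq_square)
    qed
    obtain t where t: "0 < t" "t < r" "v (a + r *\<^sub>R h) = v a + r * dir_deriv h v a
        + r\<^sup>2 / 2 * dir_deriv h (dir_deriv h v) (a + t *\<^sub>R h)"
      using second_order_taylor[OF v r] by blast
    define y where "y = a + t *\<^sub>R h"
    have "norm (y - a) = t * norm \<xi>" using t by (simp add: y_def nh)
    also have "\<dots> \<le> r * norm \<xi>" using t by (intro mult_right_mono) auto
    also have "\<dots> < r * (1 + norm \<xi>)" using r by (simp add: algebra_simps)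
    also have "\<dots> = min d1 (min d2 d3)" using pos by (simp add: r_def)
    finally have ny: "norm (y - a) < min d1 (min d2 d3)" .
    have b: "\<bar>q1 y - q1 a\<bar> < e" "\<bar>q2 y - q2 a\<bar> < e" "\<bar>q3 y - q3 a\<bar> < e"
      using ny d1(2) d2(2) d3(2) by auto
    have sq: "c\<^sup>2 \<le> 1" "s\<^sup>2 \<le> 1" "\<bar>c * s\<bar> \<le> 1"
      by (auto simp: c_def s_def abs_square_le_1 abs_mult intro!: mult_le_one)
    have bound: "t * z \<le> e" if "\<bar>t\<bar> \<le> 1" "\<bar>z\<bar> < e" for t z :: real
    proof -
      have "t * z \<le> \<bar>t\<bar> * \<bar>z\<bar>" by (metis abs_ge_self abs_mult)
      also have "\<dots> \<le> 1 * e" using that by (intro mult_mono) auto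
      finally show ?thesis by simp
    qed
    have "c\<^sup>2 * (q1 y - q1 a) \<le> e" "(c * s) * (q2 y - q2 a) \<le> e" "s\<^sup>2 * (q3 y - q3 a) \<le> e"
      using b sq by (auto intro!: bound)
    then have "dir_deriv h (dir_deriv h v) y \<le> c\<^sup>2 * q1 a + 2 * (c * s) * q2 a + s\<^sup>2 * q3 a + 4 * e"
      unfolding DDh by (simp add: algebra_simps)
    then have "r\<^sup>2 / 2 * dir_deriv h (dir_deriv h v) y \<le> r\<^sup>2 / 2 * (c\<^sup>2 * q1 a + 2 * (c * s) * q2 a + s\<^sup>2 * q3 a + 4 * e)"
      by (rule mult_left_mono) simp
    then show ?thesis
      unfolding eq t(3) y_def[symmetric] u_def c_def[symmetric] s_def[symmetric] Dh \<alpha>_def[symmetric] \<beta>_def[symmetric]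
      by simp
  qed
  \<comment> \<open>An explicit antiderivative of \<open>u\<close>, whose oscillating terms drop out
    over a full turn.\<close>
  define U where "U \<theta> = v a * \<theta> + r * (sin \<theta> * \<alpha> - cos \<theta> * \<beta>)
    + r\<^sup>2 / 2 * ((\<theta> + sin \<theta> * cos \<theta>) / 2 * q1 a + (sin \<theta>)\<^sup>2 * q2 a + (\<theta> - sin \<theta> * cos \<theta>) / 2 * q3 a + 4 * e * \<theta>)" for \<theta>
  have U: "(U has_real_derivative u \<theta>) (at \<theta>)" for \<theta>
  proof -
    have c2: "1 + (cos \<theta> * cos \<theta> - sin \<theta> * sin \<theta>) = 2 * (cos \<theta>)\<^sup>2" "1 - (cos \<theta> * cos \<theta> - sin \<theta> * sin \<theta>) = 2 * (sin \<theta>)\<^sup>2"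
      using sin_cos_squared_add[of \<theta>] by (simp_all add: power2_eq_square)
    have "(U has_real_derivative v a + r * (cos \<theta> * \<alpha> - - sin \<theta> * \<beta>)
       + r\<^sup>2 / 2 * ((1 + (cos \<theta> * cos \<theta> - sin \<theta> * sin \<theta>)) / 2 * q1 a + 2 * (cos \<theta> * sin \<theta>) * q2 a
          + (1 - (cos \<theta> * cos \<theta> - sin \<theta> * sin \<theta>)) / 2 * q3 a + 4 * e)) (at \<theta>)"
      unfolding U_def by (auto intro!: derivative_eq_intros simp: field_simps)
    then show ?thesis unfolding c2 by (simp add: u_def)
  qed
  have I: "(u has_integral U (2 * pi) - U 0) {0..2 * pi}"
    using U by (intro fundamental_theorem_of_calculus)
       (auto intro: has_field_derivative_at_within simp flip: has_real_derivative_iff_has_vector_derivative)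
  have "(\<lambda>\<theta>. v (a + cis \<theta> *s (r *\<^sub>R \<xi>))) integrable_on {0..2 * pi}"
    and mean: "v a \<le> 1 / (2 * pi) * integral {0..2 * pi} (\<lambda>\<theta>. v (a + cis \<theta> *s (r *\<^sub>R \<xi>)))"
    using psh set_lebesgue_integral_eq_integral(1) unfolding plurisubharmonic_def by blast+
  then have "integral {0..2 * pi} (\<lambda>\<theta>. v (a + cis \<theta> *s (r *\<^sub>R \<xi>))) \<le> U (2 * pi) - U 0"
    using I le by (metis (no_types, lifting) has_integral_le integrable_integral)
  also have "U (2 * pi) - U 0 = 2 * pi * (v a + r\<^sup>2 * N / 8)"
    by (simp add: U_def e_def N_def field_simps)
  finally have "1 / (2 * pi) * integral {0..2 * pi} (\<lambda>\<theta>. v (a + cis \<theta> *s (r *\<^sub>R \<xi>))) \<le> v a + r\<^sup>2 * N / 8"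
    by (simp add: field_simps)
  with mean have "r\<^sup>2 * N \<ge> 0" by linarith
  moreover have "r\<^sup>2 * N < 0" using N r by (simp add: mult_pos_neg)
  ultimately show False by simp
qed

section \<open>The phase and its derivatives\<close>

definition phase :: "('a::real_normed_vector \<Rightarrow> real) \<Rightarrow> 'a \<Rightarrow> real" where
  "phase v x = euler v x / 2 - v x"

lemma phase_has_derivative:
  fixes v :: "'a::euclidean_space \<Rightarrow> real"
  assumes "smooth v"
  shows "(phase v has_derivative (\<lambda>h. (euler (dir_deriv h v) x - dir_deriv h v x) / 2)) (at x)"
proof -
  have "((\<lambda>x. (1 / 2) * euler v x - v x) has_derivative
     (\<lambda>h. (1 / 2) * (dir_deriv h v x + euler (dir_deriv h v) x) - dir_deriv h v x)) (at x)"
    by (intro has_derivative_diff has_derivative_mult_right euler_has_derivative smooth_has_derivative assms)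
  moreover have "phase v = (\<lambda>x. (1 / 2) * euler v x - v x)" by (rule ext) (simp add: phase_def)
  moreover have "(1 / 2) * (dir_deriv h v x + euler (dir_deriv h v) x) - dir_deriv h v x
    = (euler (dir_deriv h v) x - dir_deriv h v x) / 2" for h by (simp add: field_simps)
  ultimately show ?thesis by simp
qed

lemma continuous_on_phase:
  fixes v :: "'a::euclidean_space \<Rightarrow> real"
  assumes "smooth v"
  shows "continuous_on S (phase v)"
  by (rule has_derivative_continuous_on) (rule has_derivative_at_withinI[OF phase_has_derivative[OF assms]])

text \<open>The second differentiation produces one more commutator term, which cancels the
  derivative of \<open>- dir_deriv h v\<close>; the coefficient 1/2 in \<open>phase\<close> is the
  one for which this happens.\<close>

lemma phase_derivative_has_derivative:
  fixes v :: "'a::euclidean_space \<Rightarrow> real"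
  assumes "smooth v"
  shows "((\<lambda>x. (euler (dir_deriv h v) x - dir_deriv h v x) / 2) has_derivative
     (\<lambda>k. euler (dir_deriv k (dir_deriv h v)) x / 2)) (at x)"
proof -
  have "((\<lambda>x. (euler (dir_deriv h v) x - dir_deriv h v x) / 2) has_derivative
     (\<lambda>k. ((dir_deriv k (dir_deriv h v) x + euler (dir_deriv k (dir_deriv h v)) x) - dir_deriv k (dir_deriv h v) x) / 2)) (at x)"
    by (intro bounded_linear.has_derivative[OF bounded_linear_divide] has_derivative_diff euler_has_derivative smooth_has_derivative smooth_dir_deriv assms)
  then show ?thesis by simp
qed

lemma line2_phase:
  fixes v :: "'a::euclidean_space \<Rightarrow> real"
  assumes "smooth v"
  shows "line2 (phase v) x h (euler (dir_deriv h (dir_deriv h v)) x / 2)"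
  unfolding line2_def
proof (intro exI conjI always_eventually allI)
  show "((\<lambda>s. phase v (x + s *\<^sub>R h)) has_real_derivative
    (euler (dir_deriv h v) (x + s *\<^sub>R h) - dir_deriv h v (x + s *\<^sub>R h)) / 2) (at s)" for s
    by (rule has_derivative_line[OF phase_has_derivative[OF assms]])
  show "((\<lambda>s. (euler (dir_deriv h v) (x + s *\<^sub>R h) - dir_deriv h v (x + s *\<^sub>R h)) / 2) has_real_derivative
    euler (dir_deriv h (dir_deriv h v)) x / 2) (at 0)"
    using has_derivative_line[where s = 0, OF phase_derivative_has_derivative[OF assms]] by simp
qed

text \<open>The direction \<open>h\<close> is exchanged with the radial direction so that it becomes
  the outermost one, where linearity is plain.\<close>

lemma bilinear_euler_second_dir_deriv:
  fixes f :: "'a::euclidean_space \<Rightarrow> real"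
  assumes "smooth f"
  shows "bilinear (\<lambda>h k. euler (dir_deriv h (dir_deriv k f)) x)"
proof -
  have "euler (dir_deriv h (dir_deriv k f)) x = dir_deriv h (dir_deriv x (dir_deriv k f)) x" for h k
    unfolding euler_def by (rule dir_deriv_commute) (intro smooth_dir_deriv assms)
  moreover have "linear (\<lambda>h. dir_deriv h (dir_deriv x (dir_deriv k f)) x)" for k
    by (intro dir_deriv_linear smooth_dir_deriv assms)
  moreover have "euler (dir_deriv h (dir_deriv k f)) x = euler (dir_deriv k (dir_deriv h f)) x" for h k
  proof -
    have "dir_deriv h (dir_deriv k f) = dir_deriv k (dir_deriv h f)"
      by (rule ext) (rule dir_deriv_commute[OF assms])
    then show ?thesis by simp
  qed
  ultimately show ?thesis unfolding bilinear_def by (metis (no_types, lifting) ext)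
qed

lemma phase_eq_ln_det:
  assumes "smooth v" "solves_equation v"
  shows "phase v x = ln (Re (det (complex_hessian v x)))"
proof -
  have "x \<bullet> gradient v x = euler v x"
    unfolding gradient_def euler_def
    by (subst dir_deriv_sum_Basis[OF assms(1)]) (simp add: inner_sum_right mult.commute)
  then show ?thesis using assms(2) by (simp add: solves_equation_def phase_def)
qed

text \<open>
  The second derivative of the phase in a direction \<open>h\<close> is half the Euler derivative of
  \<open>D\<^sub>h D\<^sub>h v\<close>, and the Euler derivative of \<open>ln det (H v)\<close> is the trace of that of \<open>H v\<close> in the frame; these cancel.
\<close>

lemma phase_harmonic:
  fixes v :: "complex ^ 'm::finite \<Rightarrow> real"
  assumes v: "smooth v" "solves_equation v" and w: "frame (complex_hessian v x) w"
  shows "has_drift_laplacian w (phase v) x 0"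
proof -
  let ?E = "\<lambda>h k. euler (dir_deriv h (dir_deriv k v)) x"
  have line: "((\<lambda>s. dir_deriv h (dir_deriv k v) (x + s *\<^sub>R x)) has_real_derivative ?E h k) (at 0)" for h k
    using dir_deriv_line[where x = x and h = x and s = 0, OF smooth_dir_deriv[OF smooth_dir_deriv[OF v(1)]]] by (simp add: euler_def)
  have ofr: "((\<lambda>s. complex_of_real (f s)) has_vector_derivative of_real f') (at 0)"
    if "(f has_real_derivative f') (at 0)" for f f'
    using bounded_linear.has_vector_derivative[OF bounded_linear_of_real] that
    by (auto simp: has_real_derivative_iff_has_vector_derivative)
  have "((\<lambda>s. complex_hessian v (x + s *\<^sub>R x) $ i $ j) has_vector_derivative
      levi_matrix ?E $ i $ j) (at 0)" for i j
    unfolding complex_hessian_eq[OF v(1)] levi_matrix_def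
    by (simp, intro has_vector_derivative_divide has_vector_derivative_add has_vector_derivative_diff has_vector_derivative_mult_right ofr line)
  moreover have "frame (complex_hessian v (x + 0 *\<^sub>R x)) w" using w by simp
  ultimately have "((\<lambda>s. ln (Re (det (complex_hessian v (x + s *\<^sub>R x))))) has_real_derivative
      (\<Sum>k\<in>UNIV. Re (herm_form (levi_matrix ?E) (w k)))) (at 0)"
    by (intro ln_det_has_derivative[where A = "\<lambda>s. complex_hessian v (x + s *\<^sub>R x)"]) auto
  then have "((\<lambda>s. phase v (x + s *\<^sub>R x)) has_real_derivative
      (\<Sum>k\<in>UNIV. (?E (w k) (w k) + ?E (\<i> *s w k) (\<i> *s w k)) / 4)) (at 0)"
    by (simp add: phase_eq_ln_det[OF v] Re_herm_form_levi_matrix[OF bilinear_euler_second_dir_deriv[OF v(1)]])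
  moreover have "0 = (\<Sum>k\<in>UNIV. (?E (w k) (w k) / 2 + ?E (\<i> *s w k) (\<i> *s w k) / 2) / 4)
      - (\<Sum>k\<in>UNIV. (?E (w k) (w k) + ?E (\<i> *s w k) (\<i> *s w k)) / 4) / 2"
    by (simp add: sum_divide_distrib add_divide_distrib flip: sum_subtractf)
  ultimately show ?thesis
    unfolding has_drift_laplacian_def using line2_phase[OF v(1)]
    by (intro exI[of _ "\<lambda>k. ?E (w k) (w k) / 2"] exI[of _ "\<lambda>k. ?E (\<i> *s w k) (\<i> *s w k) / 2"]
          exI[of _ "\<Sum>k\<in>UNIV. (?E (w k) (w k) + ?E (\<i> *s w k) (\<i> *s w k)) / 4"]) auto
qed

section \<open>A constant phase forces a quadratic polynomial\<close>

lemma hessian_form: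
  assumes "smooth v"
  shows "hessian v a x \<bullet> x = dir_deriv x (dir_deriv x v) a"
proof -
  have "dir_deriv x (dir_deriv x v) a = (\<Sum>b\<in>Basis. (x \<bullet> b) * dir_deriv x (dir_deriv b v) a)"
    by (subst dir_deriv_sum_Basis[OF smooth_dir_deriv[OF assms]]) (simp add: dir_deriv_commute[OF assms, of _ x])
  also have "\<dots> = (\<Sum>b\<in>Basis. (x \<bullet> b) * (\<Sum>c\<in>Basis. (x \<bullet> c) * dir_deriv b (dir_deriv c v) a))"
    by (intro sum.cong refl, subst dir_deriv_sum_Basis[OF smooth_dir_deriv[OF assms]])
       (simp add: dir_deriv_commute[OF assms])
  also have "\<dots> = hessian v a x \<bullet> x"
    unfolding hessian_def by (simp add: inner_sum_left inner_commute[of x] mult.commute)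
  finally show ?thesis by simp
qed

lemma phase_constant_imp_quadratic:
  fixes v :: "'a::euclidean_space \<Rightarrow> real"
  assumes v: "smooth v" and const: "\<And>x. phase v x = c"
  shows "v x = v 0 + 1 / 2 * (hessian v 0 x \<bullet> x)"
proof -
  have pc: "phase v = (\<lambda>x. c)" using const by auto
  have first: "euler (dir_deriv h v) y = dir_deriv h v y" for h y
  proof -
    have "dir_deriv h (phase v) y = (euler (dir_deriv h v) y - dir_deriv h v y) / 2"
      by (rule dir_deriv_eqI[OF phase_has_derivative[OF v]])
    moreover have "dir_deriv h (phase v) y = 0"
      unfolding pc by (rule dir_deriv_eqI) (auto intro!: derivative_eq_intros)
    ultimately show ?thesis by simp
  qed
  have second: "euler (dir_deriv k (dir_deriv h v)) y = 0" for h k y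
  proof -
    have "dir_deriv k (\<lambda>y. (euler (dir_deriv h v) y - dir_deriv h v y) / 2) y = euler (dir_deriv k (dir_deriv h v)) y / 2"
      by (rule dir_deriv_eqI[OF phase_derivative_has_derivative[OF v]])
    moreover have "dir_deriv k (\<lambda>y. (euler (dir_deriv h v) y - dir_deriv h v y) / 2) y = 0"
      unfolding first by (rule dir_deriv_eqI) (auto intro!: derivative_eq_intros)
    ultimately show ?thesis by simp
  qed
  let ?F = "dir_deriv x (dir_deriv x v)"
  have F: "smooth ?F" by (intro smooth_dir_deriv v)
  have line: "((\<lambda>s. ?F (0 + s *\<^sub>R x)) has_real_derivative dir_deriv x ?F (0 + s *\<^sub>R x)) (at s)" for s
    by (rule dir_deriv_line[OF F])
  \<comment> \<open>At \<open>s x\<close> the slope along the ray, times \<open>s\<close>, is the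
    Euler derivative, which vanishes. The argument fails at \<open>s = 0\<close>, where continuity
    takes over.\<close>
  have "dir_deriv x ?F (0 + s *\<^sub>R x) = 0" if "s > 0" for s
  proof -
    have "s * dir_deriv x ?F (s *\<^sub>R x) = euler ?F (s *\<^sub>R x)"
      unfolding euler_def using linear_scale[OF dir_deriv_linear[OF F]] by simp
    then show ?thesis using second that by simp
  qed
  then have "((\<lambda>s. ?F (0 + s *\<^sub>R x)) has_real_derivative 0) (at s)" if "s > 0" for s
    using line[of s] that by simp
  moreover have "continuous_on {0..1} (\<lambda>s. ?F (0 + s *\<^sub>R x))"
    using line by (blast intro!: continuous_at_imp_continuous_on DERIV_isCont)
  ultimately have const: "?F (s *\<^sub>R x) = ?F 0" if "0 < s" "s < 1" for s
    using DERIV_isconst2[of 0 1 "\<lambda>s. ?F (0 + s *\<^sub>R x)" s] that by simp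
  obtain t where t: "0 < t" "t < 1" "v (0 + 1 *\<^sub>R x) = v 0 + 1 * dir_deriv x v 0 + 1\<^sup>2 / 2 * ?F (0 + t *\<^sub>R x)"
    using second_order_taylor[OF v zero_less_one] by blast
  \<comment> \<open>The linear term disappears: \<open>first\<close> equates each first derivative
    with its radial derivative, and at the origin the radial direction is 0.\<close>
  have "dir_deriv x v 0 = euler (dir_deriv x v) 0" by (rule first[symmetric])
  also have "\<dots> = 0"
    unfolding euler_def using linear_0[OF dir_deriv_linear[OF smooth_dir_deriv[OF v]]] by simp
  finally show ?thesis using t const[OF t(1,2)] by (simp add: hessian_form[OF v])
qed

section \<open>The radial case and the case of a lower bound on the Hessian\<close>

lemma radially_symmetric_phase:
  fixes v :: "'a::euclidean_space \<Rightarrow> real"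
  assumes "smooth v" "radially_symmetric v"
  shows "radially_symmetric (phase v)"
  unfolding radially_symmetric_def
proof (intro allI impI)
  fix x y :: 'a assume n: "norm x = norm y"
  \<comment> \<open>Dilating \<open>x\<close> and \<open>y\<close> by the same factor keeps their
    norms equal, so \<open>v\<close> agrees along both rays and the radial derivatives
    coincide.\<close>
  have "norm (x + s *\<^sub>R x) = norm (y + s *\<^sub>R y)" for s
  proof -
    have "z + s *\<^sub>R z = (1 + s) *\<^sub>R z" for z :: 'a by (simp add: algebra_simps)
    then show ?thesis using n by simp
  qed
  then have eq: "(\<lambda>s. v (x + s *\<^sub>R x)) = (\<lambda>s. v (y + s *\<^sub>R y))"
    using assms(2) unfolding radially_symmetric_def by blast
  have "((\<lambda>s. v (z + s *\<^sub>R z)) has_real_derivative euler v z) (at 0)" for z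
    using dir_deriv_line[OF assms(1), of z z 0] by (simp add: euler_def)
  then have "euler v x = euler v y" using eq DERIV_unique by metis
  moreover have "v x = v y" using assms(2) n unfolding radially_symmetric_def by blast
  ultimately show "phase v x = phase v y" by (simp add: phase_def)
qed

text \<open>The concavity of the square root removes half of the contribution \<open>S\<close> of
  the direction of \<open>x\<close>, and \<open>T - S\<close> comes from the orthogonal ones.
  Together they stay below \<open>(m - 1/2) / \<kappa> = \<rho>^2 (2m - 1) / c\<close>, hence below
  the drift term \<open>\<rho>^2\<close>.\<close>

lemma norm_supersolution:
  fixes A :: "complex ^ 'm ^ 'm::finite" and x :: "complex ^ 'm"
  assumes w: "frame A w" and c: "c > 2 * real CARD('m) - 1" and x: "x \<noteq> 0"
    and low: "\<And>\<xi>. c / (2 * (norm x)\<^sup>2) * (norm \<xi>)\<^sup>2 \<le> Re (herm_form A \<xi>)"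
  shows "\<exists>l<0. has_drift_laplacian w norm x l"
proof -
  define \<rho> where "\<rho> = norm x"
  define \<kappa> where "\<kappa> = c / (2 * \<rho>\<^sup>2)"
  define n where "n = (1 / \<rho>) *\<^sub>R x"
  have card: "real CARD('m) \<ge> 1" by (simp add: Suc_leI)
  have \<rho>: "\<rho> > 0" using x by (simp add: \<rho>_def)
  have c0: "c > 0" using c card by linarith
  have \<kappa>: "\<kappa> > 0" using \<rho> c0 by (simp add: \<kappa>_def)
  have low': "\<kappa> * (norm \<xi>)\<^sup>2 \<le> Re (herm_form A \<xi>)" for \<xi>
    using low[of \<xi>] by (simp add: \<kappa>_def \<rho>_def)
  have nn: "norm n = 1" using \<rho> by (simp add: n_def \<rho>_def)
  define S where "S = (\<Sum>k\<in>UNIV. (cmod (cinner n (w k)))\<^sup>2)"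
  define T where "T = (\<Sum>k\<in>UNIV. (norm (w k))\<^sup>2)"
  have xn: "x = complex_of_real \<rho> *s n" using \<rho> by (simp add: n_def vec_eq_iff scaleR_conv_of_real[where 'a = complex])
  have Sx: "(\<Sum>k\<in>UNIV. (cmod (cinner (x - 0) (w k)))\<^sup>2) = \<rho>\<^sup>2 * S"
    unfolding S_def by (subst xn) (simp add: cinner_scale_left norm_mult power_mult_distrib sum_distrib_left)
  have T1: "T - S \<le> (real CARD('m) - 1) / \<kappa>"
    using frame_tangential_upper[OF w \<kappa> low' nn] by (simp add: T_def S_def sum_subtractf)
  have S1: "S \<le> 1 / \<kappa>" using frame_cinner_upper[OF w \<kappa> low', of n] nn by (simp add: S_def)
  have F: "\<forall>\<^sub>F t in nhds ((norm (x - 0))\<^sup>2). (sqrt has_real_derivative inverse (sqrt t) / 2) (at t)"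
  proof -
    have "\<forall>\<^sub>F t in nhds ((norm (x - 0))\<^sup>2). t \<in> {0<..}"
      using x by (intro eventually_nhds_in_open) auto
    then show ?thesis by eventually_elim (auto intro!: DERIV_real_sqrt)
  qed
  have F': "((\<lambda>t. inverse (sqrt t) / 2) has_real_derivative - (1 / (4 * \<rho>^3))) (at ((norm (x - 0))\<^sup>2))"
    using \<rho> x by (auto intro!: derivative_eq_intros simp: \<rho>_def field_simps power2_eq_square power3_eq_cube)
  have "has_drift_laplacian w (\<lambda>z. sqrt ((norm (z - 0))\<^sup>2)) x
     (- (1 / (4 * \<rho>^3)) * (\<rho>\<^sup>2 * S) + inverse (sqrt ((norm (x - 0))\<^sup>2)) / 2 * T
       - inverse (sqrt ((norm (x - 0))\<^sup>2)) / 2 * ((x - 0) \<bullet> x))"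
    using has_drift_laplacian_radial[OF F F', of w] unfolding Sx T_def .
  moreover have "- (1 / (4 * \<rho>^3)) * (\<rho>\<^sup>2 * S) + inverse (sqrt ((norm (x - 0))\<^sup>2)) / 2 * T
       - inverse (sqrt ((norm (x - 0))\<^sup>2)) / 2 * ((x - 0) \<bullet> x) = 1 / (2 * \<rho>) * ((T - S) + S / 2 - \<rho>\<^sup>2)"
    using \<rho> by (simp add: \<rho>_def[symmetric] power2_norm_eq_inner[symmetric] field_simps power2_eq_square power3_eq_cube)
  moreover have "(T - S) + S / 2 - \<rho>\<^sup>2 < 0"
  proof -
    have "(T - S) + S / 2 \<le> (real CARD('m) - 1) / \<kappa> + (1 / \<kappa>) / 2" using T1 S1 by (intro add_mono divide_right_mono) auto
    also have "\<dots> = \<rho>\<^sup>2 * ((2 * real CARD('m) - 1) / c)"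
      using \<rho> c0 by (simp add: \<kappa>_def field_simps)
    also have "\<dots> < \<rho>\<^sup>2 * 1" using c c0 \<rho> by (intro mult_strict_left_mono) auto
    finally show ?thesis by simp
  qed
  then have "1 / (2 * \<rho>) * ((T - S) + S / 2 - \<rho>\<^sup>2) < 0" using \<rho> by (intro mult_pos_neg) auto
  ultimately show ?thesis by auto
qed


lemma radial_phase_constant:
  fixes v :: "complex ^ 'm::finite \<Rightarrow> real"
  assumes v: "smooth v" "solves_equation v" and pd: "\<And>x. posdef (complex_hessian v x)"
    and rad: "radially_symmetric v"
  shows "phase v x = phase v 0"
proof -
  have sym: "phase v y = phase v z" if "norm y = norm z" for y z
    using radially_symmetric_phase[OF v(1) rad] that unfolding radially_symmetric_def by blast
  define r where "r = norm x"
  have "r + 1 \<ge> 0" by (simp add: r_def)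
  \<comment> \<open>The centre of the barrier has to lie outside the ball.\<close>
  then obtain y :: "complex ^ 'm" where y: "norm y = r + 1" using vector_choose_size by blast
  have K: "compact (cball (0 :: complex ^ 'm) r)" "y \<notin> cball 0 r" using y by auto
  have U: "open (ball (0 :: complex ^ 'm) r)" "ball (0 :: complex ^ 'm) r \<subseteq> cball 0 r" by auto
  have x0: "0 \<in> cball (0 :: complex ^ 'm) r" by (simp add: r_def)
  note A = continuous_on_complex_hessian[OF v(1), of "cball 0 r"]
  note cont = continuous_on_phase[OF v(1)]
  have bd: "phase v z = phase v x" if "z \<in> cball 0 r - ball 0 r" for z
    using that by (intro sym) (auto simp: r_def)
  have "phase v x \<le> phase v 0"
  proof (rule weak_min_principle[OF K A pd cont _ U _ x0])
    show "phase v x \<le> phase v z" if "z \<in> cball 0 r - ball 0 r" for z using bd[OF that] by simp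
  qed (rule phase_harmonic[OF v])
  moreover have "- phase v x \<le> - phase v 0"
  proof (rule weak_min_principle[OF K A pd _ _ U _ x0])
    show "continuous_on (cball 0 r) (\<lambda>z. - phase v z)" by (intro continuous_intros cont)
    show "- phase v x \<le> - phase v z" if "z \<in> cball 0 r - ball 0 r" for z using bd[OF that] by simp
    show "has_drift_laplacian w (\<lambda>z. - phase v z) z 0" if "frame (complex_hessian v z) w" for z w
      \<comment> \<open>The negative is obtained as \<open>\<phi> + (- 2) \<phi>\<close>.\<close>
      using has_drift_laplacian_add_scale[OF phase_harmonic[OF v that] phase_harmonic[OF v that], of "- 2"] by simp
  qed
  ultimately show ?thesis by simp
qed

lemma phase_attains_min:
  fixes v :: "complex ^ 'm::finite \<Rightarrow> real"
  assumes v: "smooth v" "solves_equation v" and pd: "\<And>x. posdef (complex_hessian v x)"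
    and c: "c > 2 * real CARD('m) - 1" and R: "R > 0"
    and low: "\<And>x \<xi>. norm x \<ge> R \<Longrightarrow>
        c / (2 * (norm x)\<^sup>2) * (norm \<xi>)\<^sup>2 \<le> Re (herm_form (complex_hessian v x) \<xi>)"
  obtains p where "\<And>x. phase v p \<le> phase v x"
proof -
  let ?N = "real CARD('m)"
  have card: "?N \<ge> 1" by (simp add: Suc_leI)
  have c0: "c > 0" using c card by linarith
  note cont = continuous_on_phase[OF v(1)]
  \<comment> \<open>The minimum over the inner ball is the candidate; the comparison outside shows
    that the phase never falls below it.\<close>
  obtain p where p: "p \<in> cball 0 R" "\<And>x. x \<in> cball 0 R \<Longrightarrow> phase v p \<le> phase v x"
    using continuous_attains_inf[OF _ _ cont, of "cball 0 R"] R by auto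
  define M where "M = phase v p"
  have far: "phase v x \<ge> ?N * ln (c / (2 * (norm x)\<^sup>2))" if "norm x \<ge> R" for x
  proof -
    have "norm x > 0" using that R by linarith
    then have "c / (2 * (norm x)\<^sup>2) > 0" using c0 by simp
    then show ?thesis unfolding phase_eq_ln_det[OF v]
      by (rule det_lower_bound[OF hermitian_complex_hessian[OF v(1)] _ low[OF that]])
  qed
  have "M \<le> phase v x" for x
  proof (cases "norm x \<le> R")
    case True
    then show ?thesis using p(2)[of x] by (simp add: M_def)
  next
    case False
    then have x: "norm x > R" by simp
    show ?thesis
    proof (rule field_le_epsilon)
      fix \<epsilon> :: real assume "\<epsilon> > 0"
      \<comment> \<open>Makes the perturbation at \<open>x\<close> equal to
        \<open>\<epsilon>\<close>.\<close>
      define e where "e = \<epsilon> / norm x"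
      have "norm x > 0" using x R by linarith
      then have e: "e > 0" using \<open>\<epsilon> > 0\<close> by (simp add: e_def)
      \<comment> \<open>Linear growth beats the logarithmic decrease, so on a sphere of large radius
        \<open>r\<close> the perturbed phase is at least \<open>M\<close>.\<close>
      have "filterlim (\<lambda>r. ?N * ln (c / (2 * r\<^sup>2)) + e * r) at_top at_top"
        using e c0 card by real_asymp
      then have "\<forall>\<^sub>F r in at_top. ?N * ln (c / (2 * r\<^sup>2)) + e * r \<ge> M \<and> r \<ge> norm x"
        using eventually_ge_at_top[of "norm x"] by (auto simp: filterlim_at_top intro: eventually_conj)
      then obtain r where r: "?N * ln (c / (2 * r\<^sup>2)) + e * r \<ge> M" "r \<ge> norm x"
        using eventually_happens'[OF trivial_limit_at_top_linorder] by blast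
      define K where "K = cball (0 :: complex ^ 'm) r - ball 0 R"
      define U where "U = ball (0 :: complex ^ 'm) r - cball 0 R"
      have K: "compact K" unfolding K_def by (intro compact_diff) auto
      have U: "open U" "U \<subseteq> K" unfolding K_def U_def by auto
      have "x \<in> K" using x r by (auto simp: K_def)
      have "M \<le> phase v x + e * norm x"
      proof (rule strict_min_principle[OF K _ U _ _ \<open>x \<in> K\<close>])
        show "continuous_on K (\<lambda>z. phase v z + e * norm z)" by (intro continuous_intros cont)
        fix z assume "z \<in> K - U"
        then consider "norm z = r" | "norm z = R" unfolding K_def U_def by force
        then show "M \<le> phase v z + e * norm z"
        proof cases
          case 1
          then have "phase v z \<ge> ?N * ln (c / (2 * r\<^sup>2))" using far[of z] x r by auto
          then show ?thesis using r 1 by simp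
        next
          case 2
          then have "M \<le> phase v z" using p(2)[of z] by (simp add: M_def)
          moreover have "e * norm z \<ge> 0" using e by simp
          ultimately show ?thesis by linarith
        qed
      next
        fix z assume "z \<in> U"
        then have z: "norm z \<ge> R" "z \<noteq> 0" using R unfolding U_def by auto
        obtain w where w: "frame (complex_hessian v z) w" using posdef_frame_exists[OF pd] ..
        obtain l where l: "l < 0" "has_drift_laplacian w norm z l"
          using norm_supersolution[OF w c z(2) low[OF z(1)]] by blast
        have "has_drift_laplacian w (\<lambda>z. phase v z + e * norm z) z (0 + e * l)"
          by (rule has_drift_laplacian_add_scale[OF phase_harmonic[OF v w] l(2)])
        moreover have "0 + e * l < 0" using e l by (simp add: mult_pos_neg)
        ultimately show "\<exists>w l. has_drift_laplacian w (\<lambda>z. phase v z + e * norm z) z l \<and> l < 0" by blast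
      qed
      then show "M \<le> phase v x + \<epsilon>" using \<open>norm x > 0\<close> by (simp add: e_def)
    qed
  qed
  then show thesis using that unfolding M_def by blast
qed

theorem theorem1p3:
  fixes v :: "complex ^ 'm::finite \<Rightarrow> real"
  assumes "smooth v"
    and "plurisubharmonic v"
    and "solves_equation v"
    and "(\<exists>\<delta>>0. \<exists>R>0. \<forall>x. norm x \<ge> R \<longrightarrow>
            herm_le (mat (complex_of_real ((2 * real CARD('m) - 1 + \<delta>) / (2 * (norm x)\<^sup>2))))
              (complex_hessian v x))
         \<or> radially_symmetric v"
  shows "\<forall>x. v x = v 0 + 1 / 2 * (hessian v 0 x \<bullet> x)"
proof -
  note v = assms(1,3)
  \<comment> \<open>Plurisubharmonicity makes the form semidefinite, and the equation makes its
    determinant nonzero.\<close>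
  have pd: "posdef (complex_hessian v x)" for x
  proof (rule psd_nondegenerate_posdef[OF hermitian_complex_hessian[OF v(1)]
        plurisubharmonic_hessian_nonneg[OF assms(1,2)]])
    have "Re (det (complex_hessian v x)) > 0" using v(2) unfolding solves_equation_def by blast
    then show "det (complex_hessian v x) \<noteq> 0" by auto
  qed
  obtain p where p: "phase v x = phase v p" for x
    using assms(4)
  proof
    assume "radially_symmetric v"
    then show thesis using radial_phase_constant[OF v pd] that by blast
  next
    assume "\<exists>\<delta>>0. \<exists>R>0. \<forall>x. norm x \<ge> R \<longrightarrow>
            herm_le (mat (complex_of_real ((2 * real CARD('m) - 1 + \<delta>) / (2 * (norm x)\<^sup>2))))
              (complex_hessian v x)"
    then obtain \<delta> R where d: "\<delta> > 0" and R: "R > 0" and le: "\<And>x. norm x \<ge> R \<Longrightarrow>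
            herm_le (mat (complex_of_real ((2 * real CARD('m) - 1 + \<delta>) / (2 * (norm x)\<^sup>2))))
              (complex_hessian v x)" by blast
    define c where "c = 2 * real CARD('m) - 1 + \<delta>"
    have low: "c / (2 * (norm x)\<^sup>2) * (norm \<xi>)\<^sup>2 \<le> Re (herm_form (complex_hessian v x) \<xi>)"
      if "norm x \<ge> R" for x \<xi>
    proof -
      have "Re (herm_form (mat (complex_of_real k)) \<xi>) = k * (norm \<xi>)\<^sup>2" for k
        by (simp add: herm_form_eq_hform hform_mat cinner_self del: of_real_power)
      then show ?thesis using le[OF that] unfolding herm_le_def c_def by metis
    qed
    have "c > 2 * real CARD('m) - 1" using d by (simp add: c_def)
    then obtain p where p: "\<And>x. phase v p \<le> phase v x"
      using phase_attains_min[OF v pd _ R low] by blast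
    have diff: "phase v differentiable (at x)" for x
      using phase_has_derivative[OF v(1)] unfolding differentiable_def by blast
    have "phase v x = phase v p" for x
      by (rule strong_min_principle[OF continuous_on_complex_hessian[OF v(1)] pd diff phase_harmonic[OF v] p])
    then show thesis using that by blast
  qed
  show ?thesis using phase_constant_imp_quadratic[OF v(1) p] by blast
qed

end
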